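(* Let $1<p<\infty$ and $\sigma>1$, let $\Omega$, $Q$, $v$ satisfy the standing assumptions listed in the context, and let $f\in L^{\sigma'}(\Omega,v)$. There are constants $\gamma>0$ and $C>0$ such that every bounded weak solution $(u,\nabla u)\in QH^{1,p}_0(\Omega,v)$ of the Dirichlet problem $$-\frac1v\,\mathrm{div}\big(|\sqrt Q\nabla u|^{p-2}Q\nabla u\big)=f\ \text{ in }\Omega,\qquad u=0\ \text{ on }\partial\Omega,$$ satisfies $$\int_\Omega e^{\gamma u}\,v\,dx\leq C\,v(\Omega),\qquad v(\Omega)=\int_\Omega v\,dx .$$ Both $\gamma$ and $C$ are independent of the weak solution $(u,\nabla u)$.
   Context: Standing assumptions. $\Omega\subset\mathbb{R}^n$ is a bounded domain. $Q$ is a measurable function on $\Omega$ with values in the symmetric non-negative definite real $n\times n$ matrices, and $\omega(x)=\|Q(x)\|_{\mathrm{op}}=\sup_{|\xi|=1}|Q(x)\xi|$. $v$ is a weight, i.e. a non-negative function in $L^1_{\mathrm{loc}}(\Omega,dx)$. Weight condition: $v(x)\geq C\omega(x)^{p/2}$ for some constant $C>0$, with $\omega\in L^{p/2}_{\mathrm{loc}}(\Omega,dx)$. Sobolev inequality with gain $\sigma>1$: there is a constant $C>0$ such that $$\Big(\int_\Omega|\varphi|^{p\sigma}\,v\,dx\Big)^{1/(p\sigma)}\leq C\Big(\int_\Omega|\sqrt Q\nabla\varphi|^p\,dx\Big)^{1/p}$$ for every $\varphi\in\mathrm{Lip}_0(\Omega)$, the Lipschitz functions with compact support in $\Omega$.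 For an exponent $r>1$, $r'=r/(r-1)$; in particular $\sigma'=\sigma/(\sigma-1)$. $L^r(\Omega,v)$ is the Lebesgue space with respect to the measure $v\,dx$; "bounded" means $u\in L^\infty(\Omega,v)$. Sobolev spaces. $\mathcal{L}^p(\Omega,Q)$ is the space of measurable $\vec g:\Omega\to\mathbb{R}^n$ with $\|\vec g\|_{\mathcal{L}^p(\Omega,Q)}=(\int_\Omega|\sqrt Q\,\vec g|^p\,dx)^{1/p}<\infty$, two functions being identified if their difference has norm $0$. $QH^{1,p}_0(\Omega,v)$ is the completion of $\mathrm{Lip}_0(\Omega)$ in the norm $\|u\|_{L^p(\Omega,v)}+\|\nabla u\|_{\mathcal{L}^p(\Omega,Q)}$; i.e. the set of pairs $(u,\vec g)\in L^p(\Omega,v)\times\mathcal{L}^p(\Omega,Q)$ for which there are $u_j\in\mathrm{Lip}_0(\Omega)$ with $\|u-u_j\|_{L^p(\Omega,v)}\to0$ and $\|\vec g-\nabla u_j\|_{\mathcal{L}^p(\Omega,Q)}\to0$. One writes $\nabla u$ for $\vec g$, although $\vec g$ need not be determined by $u$. Weak solution. For $f\in L^{(p\sigma)'}(\Omega,v)$, a pair $(u,\vec g)\in QH^{1,p}_0(\Omega,v)$ is a weak solution of the Dirichlet problem above if $$\int_\Omega|\sqrt Q\,\vec g|^{p-2}\,\nabla\varphi\cdot Q\vec g\,dx=\int_\Omega f\varphi\,v\,dx$$ for every $\varphi\in\mathrm{Lip}_0(\Omega)$. (The condition $f\in L^{(p\sigma)'}(\Omega,v)$ is part of this notion; it is automatic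 when $f\in L^{\sigma'}(\Omega,v)$ and $v(\Omega)<\infty$.) *)

theory Defs
  imports "HOL-Analysis.Analysis"
begin

section \<open>Non-negative definite matrices and their square roots\<close>

definition nonneg_definite :: "real ^ 'n ^ 'n \<Rightarrow> bool" where
  "nonneg_definite A \<longleftrightarrow> transpose A = A \<and> (\<forall>\<xi>. 0 \<le> \<xi> \<bullet> (A *v \<xi>))"

text \<open>The description operator is well defined on symmetric non-negative definite matrices,
  where existence and uniqueness of the square root is a classical fact.\<close>

definition matrix_sqrt :: "real ^ 'n ^ 'n \<Rightarrow> real ^ 'n ^ 'n" where
  "matrix_sqrt A = (THE B. nonneg_definite B \<and> B ** B = A)"

definition op_norm :: "real ^ 'n ^ 'm \<Rightarrow> real" where
  "op_norm A = onorm (\<lambda>\<xi>. A *v \<xi>)"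


section \<open>Lebesgue spaces\<close>

text \<open>Elements of the Lebesgue spaces below are represented by measurable functions, without
  passing to equivalence classes.\<close>

definition Lp_norm :: "real \<Rightarrow> 'a measure \<Rightarrow> ('a \<Rightarrow> real) \<Rightarrow> real" where
  "Lp_norm r M u = (\<integral>x. \<bar>u x\<bar> powr r \<partial>M) powr (1 / r)"

definition Lp_space :: "real \<Rightarrow> 'a measure \<Rightarrow> ('a \<Rightarrow> real) set" where
  "Lp_space r M = {u \<in> borel_measurable M. integrable M (\<lambda>x. \<bar>u x\<bar> powr r)}"

definition Linf_space :: "'a measure \<Rightarrow> ('a \<Rightarrow> real) set" where
  "Linf_space M = {u \<in> borel_measurable M. \<exists>K. AE x in M. \<bar>u x\<bar> \<le> K}"

definition Lp_loc :: "real \<Rightarrow> (real ^ 'n) set \<Rightarrow> (real ^ 'n \<Rightarrow> real) set" where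
  "Lp_loc r \<Omega> = {u \<in> borel_measurable (lebesgue_on \<Omega>).
     \<forall>K. compact K \<and> K \<subseteq> \<Omega> \<longrightarrow> integrable (lebesgue_on K) (\<lambda>x. \<bar>u x\<bar> powr r)}"

text \<open>The measure \<open>v dx\<close> on \<open>\<Omega>\<close>.\<close>

definition weighted :: "(real ^ 'n) set \<Rightarrow> (real ^ 'n \<Rightarrow> real) \<Rightarrow> (real ^ 'n) measure" where
  "weighted \<Omega> v = density (lebesgue_on \<Omega>) (\<lambda>x. ennreal (v x))"

definition QLp_norm ::
    "real \<Rightarrow> (real ^ 'n) set \<Rightarrow> (real ^ 'n \<Rightarrow> real ^ 'n ^ 'n) \<Rightarrow> (real ^ 'n \<Rightarrow> real ^ 'n) \<Rightarrow> real" where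
  "QLp_norm p \<Omega> Q g = (\<integral>x. norm (matrix_sqrt (Q x) *v g x) powr p \<partial>lebesgue_on \<Omega>) powr (1 / p)"

definition QLp_space ::
    "real \<Rightarrow> (real ^ 'n) set \<Rightarrow> (real ^ 'n \<Rightarrow> real ^ 'n ^ 'n) \<Rightarrow> (real ^ 'n \<Rightarrow> real ^ 'n) set" where
  "QLp_space p \<Omega> Q = {g \<in> borel_measurable (lebesgue_on \<Omega>).
     integrable (lebesgue_on \<Omega>) (\<lambda>x. norm (matrix_sqrt (Q x) *v g x) powr p)}"


section \<open>Lipschitz functions and degenerate Sobolev spaces\<close>

text \<open>Functions on \<open>\<Omega>\<close> with compact support in \<open>\<Omega>\<close> are extended by zero to the whole space.\<close>

definition Lip0 :: "(real ^ 'n) set \<Rightarrow> (real ^ 'n \<Rightarrow> real) set" where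
  "Lip0 \<Omega> = {\<phi>. (\<exists>L. L-lipschitz_on \<Omega> \<phi>) \<and>
     compact (closure {x. \<phi> x \<noteq> 0}) \<and> closure {x. \<phi> x \<noteq> 0} \<subseteq> \<Omega>}"

text \<open>The pointwise gradient. The default value 0 is only relevant on a null set for Lipschitz
  functions, by Rademacher's theorem.\<close>

definition grad :: "(real ^ 'n \<Rightarrow> real) \<Rightarrow> real ^ 'n \<Rightarrow> real ^ 'n" where
  "grad \<phi> x = (if \<exists>D. GDERIV \<phi> x :> D then THE D. GDERIV \<phi> x :> D else 0)"

text \<open>If \<open>v\<close> is in \<open>L\<^sup>1\<^sub>l\<^sub>o\<^sub>c\<close> and the operator norm of \<open>Q\<close> is in \<open>L\<^sup>p\<^sup>/\<^sup>2\<^sub>l\<^sub>o\<^sub>c\<close>, all integrands in the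
  norms below are integrable, so that the norms are the true ones.\<close>

definition QH0 :: "real \<Rightarrow> (real ^ 'n) set \<Rightarrow> (real ^ 'n \<Rightarrow> real ^ 'n ^ 'n) \<Rightarrow>
    (real ^ 'n \<Rightarrow> real) \<Rightarrow> ((real ^ 'n \<Rightarrow> real) \<times> (real ^ 'n \<Rightarrow> real ^ 'n)) set" where
  "QH0 p \<Omega> Q v = {(u, g). u \<in> Lp_space p (weighted \<Omega> v) \<and> g \<in> QLp_space p \<Omega> Q \<and>
     (\<exists>U. (\<forall>j::nat. U j \<in> Lip0 \<Omega>) \<and>
       (\<lambda>j. Lp_norm p (weighted \<Omega> v) (\<lambda>x. u x - U j x)) \<longlonglongrightarrow> 0 \<and>
       (\<lambda>j. QLp_norm p \<Omega> Q (\<lambda>x. g x - grad (U j) x)) \<longlonglongrightarrow> 0)}"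

text \<open>Where \<open>matrix_sqrt (Q x) *v g x = 0\<close> also \<open>Q x *v g x = 0\<close>, so the integrand on the
  left-hand side vanishes there, also for \<open>p < 2\<close>.\<close>

definition weak_solution :: "real \<Rightarrow> real \<Rightarrow> (real ^ 'n) set \<Rightarrow> (real ^ 'n \<Rightarrow> real ^ 'n ^ 'n) \<Rightarrow>
    (real ^ 'n \<Rightarrow> real) \<Rightarrow> (real ^ 'n \<Rightarrow> real) \<Rightarrow>
    (real ^ 'n \<Rightarrow> real) \<Rightarrow> (real ^ 'n \<Rightarrow> real ^ 'n) \<Rightarrow> bool" where
  "weak_solution p \<sigma> \<Omega> Q v f u g \<longleftrightarrow>
     f \<in> Lp_space (p * \<sigma> / (p * \<sigma> - 1)) (weighted \<Omega> v) \<and>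
     (u, g) \<in> QH0 p \<Omega> Q v \<and>
     (\<forall>\<phi> \<in> Lip0 \<Omega>.
        (\<integral>x. norm (matrix_sqrt (Q x) *v g x) powr (p - 2) * (grad \<phi> x \<bullet> (Q x *v g x))
           \<partial>lebesgue_on \<Omega>)
        = (\<integral>x. f x * \<phi> x \<partial>weighted \<Omega> v))"

end

theory Submission
  imports Defs
begin

text \<open>For a bounded increasing \<open>T\<close> with \<open>0 < T' \<le> 1\<close> and \<open>T 0 = 0\<close>, apply the Sobolev inequality to
  \<open>H(u) = exp (\<beta> T(u)) - 1\<close> and test the equation with \<open>P(u) = exp (p \<beta> T(u)) - 1\<close>. Since
  \<open>H'\<^sup>p \<le> (\<beta>\<^sup>p\<^sup>-\<^sup>1 / p) P'\<close>, this bounds \<open>\<parallel>H(u)\<^sup>p\<parallel>\<^sub>\<sigma>\<close> by a multiple of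
  \<open>\<beta>\<^sup>p\<^sup>-\<^sup>1 \<parallel>f\<parallel> \<parallel>P(u)\<parallel>\<^sub>\<sigma>\<close>, and \<open>|P| \<le> 2\<^sup>p (|H|\<^sup>p + 1)\<close>. Because \<open>p > 1\<close>, for small \<open>\<beta>\<close> the
  right-hand side is absorbed, which leaves \<open>\<integral> |H(u)|\<^sup>p\<^sup>\<sigma> v dx \<le> v(\<Omega>)\<close>. The choice
  \<open>T t = n arctan (t / n)\<close> and Fatou's lemma as \<open>n \<rightarrow> \<infinity>\<close> remove the truncation. Both inequalities pass
  from Lipschitz functions to \<open>u\<close> by dominated convergence; only their form up to constants is
  needed, so elementary pointwise bounds replace the Hoelder and Minkowski inequalities.\<close>

section \<open>Square roots of non-negative definite matrices\<close>

lemma symmetric_matrix_inner: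
  fixes A :: "real ^ 'n ^ 'n"
  assumes "transpose A = A"
  shows "(A *v x) \<bullet> y = x \<bullet> (A *v y)"
  by (metis assms dot_lmul_matrix transpose_matrix_vector)

lemma symmetric_matrixI:
  fixes A :: "real ^ 'n ^ 'n"
  assumes "\<And>x y. (A *v x) \<bullet> y = x \<bullet> (A *v y)"
  shows "transpose A = A"
proof -
  have "transpose A *v x = A *v x" for x
  proof -
    have "(transpose A *v x - A *v x) \<bullet> y = 0" for y
      using assms[of x y] by (simp add: inner_diff_left dot_lmul_matrix)
    from this[of "transpose A *v x - A *v x"] show ?thesis
      by simp
  qed
  then show ?thesis
    by (simp add: matrix_eq)
qed

text \<open>By compactness, \<open>x \<bullet> (A *v x)\<close> attains its maximum on the unit
  sphere of \<open>S\<close>. At a maximiser \<open>e\<close> the first variation vanishes, so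
  \<open>A *v e - l *\<^sub>R e\<close> is orthogonal to \<open>S\<close>; by invariance it also
  lies in \<open>S\<close>, hence it is 0.\<close>

lemma symmetric_matrix_eigenvector:
  fixes A :: "real ^ 'n ^ 'n"
  assumes sym: "transpose A = A" and S: "subspace S" "S \<noteq> {0}"
    and inv: "\<And>x. x \<in> S \<Longrightarrow> A *v x \<in> S"
  obtains e l where "e \<in> S" "norm e = 1" "A *v e = l *\<^sub>R e"
proof -
  obtain z where z: "z \<in> S" "z \<noteq> 0"
    using S subspace_0 by fastforce
  have cpt: "compact (S \<inter> sphere 0 1)"
    using closed_subspace[OF S(1)] by (simp add: closed_Int_compact)
  have "z /\<^sub>R norm z \<in> S \<inter> sphere 0 1"
    using z by (simp add: subspace_scale[OF S(1)])
  then have ne: "S \<inter> sphere 0 1 \<noteq> {}" by blast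
  have "continuous_on (S \<inter> sphere 0 1) (\<lambda>x. x \<bullet> (A *v x))"
    by (intro continuous_intros matrix_vector_mult_linear_continuous_on)
  from continuous_attains_sup[OF cpt ne this]
  obtain e where "e \<in> S \<inter> sphere 0 1"
    and "\<forall>y\<in>S \<inter> sphere 0 1. y \<bullet> (A *v y) \<le> e \<bullet> (A *v e)"
    by (elim bexE)
  then have e: "e \<in> S" "norm e = 1"
    and max: "\<And>y. y \<in> S \<inter> sphere 0 1 \<Longrightarrow> y \<bullet> (A *v y) \<le> e \<bullet> (A *v e)"
    by (blast, simp, blast)
  define l where "l = e \<bullet> (A *v e)"
  have le: "y \<bullet> (A *v y) \<le> l * (y \<bullet> y)" if "y \<in> S" for y
  proof (cases "y = 0")
    case False
    have "y /\<^sub>R norm y \<in> S \<inter> sphere 0 1"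
      using that False by (simp add: subspace_scale[OF S(1)])
    from max[OF this] have "(y \<bullet> (A *v y)) / (norm y * norm y) \<le> l"
      by (simp add: l_def matrix_vector_mult_scaleR divide_simps)
    then show ?thesis
      using False by (simp add: divide_simps power2_norm_eq_inner[symmetric] power2_eq_square split: if_splits)
  qed simp
  have orth: "y \<bullet> (A *v e - l *\<^sub>R e) = 0" if "y \<in> S" for y
  proof -
    define b c where "b = y \<bullet> (A *v e - l *\<^sub>R e)" and "c = l * (y \<bullet> y) - y \<bullet> (A *v y)"
    \<comment> \<open>This is \<open>le\<close> at \<open>e + t *\<^sub>R y\<close>, after the terms
      of order zero in \<open>t\<close> cancel.\<close>
    have quad: "2 * t * b \<le> t\<^sup>2 * c" for t
    proof -
      have "e + t *\<^sub>R y \<in> S"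
        using that e S(1) by (simp add: subspace_add subspace_scale)
      from le[OF this] show ?thesis
        using e(2) symmetric_matrix_inner[OF sym, of y e]
        unfolding b_def c_def l_def
        by (simp add: algebra_simps inner_add_left inner_add_right inner_diff_right
            power2_eq_square inner_commute norm_eq_1)
    qed
    have "b = 0"
    proof (rule ccontr)
      assume "b \<noteq> 0"
      define d where "d = 1 + \<bar>c\<bar>"
      have d: "d > 0" "c < d" by (auto simp: d_def)
      \<comment> \<open>As \<open>d\<close> exceeds \<open>\<bar>c\<bar>\<close>, the increment
        \<open>b / d\<close> is so small that the linear term beats the quadratic one.\<close>
      have "2 * (b / d) * b \<le> (b / d)\<^sup>2 * c" by (rule quad)
      then have "2 * b\<^sup>2 * d \<le> b\<^sup>2 * c"
        using d(1) by (simp add: field_simps power2_eq_square)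
      moreover have "b\<^sup>2 * c < b\<^sup>2 * d" "0 < b\<^sup>2 * d"
        using \<open>b \<noteq> 0\<close> d by auto
      ultimately show False by linarith
    qed
    then show ?thesis by (simp add: b_def)
  qed
  have "A *v e - l *\<^sub>R e \<in> S"
    using inv[OF e(1)] e(1) S(1) by (simp add: subspace_diff subspace_scale)
  from orth[OF this] have "A *v e = l *\<^sub>R e" by simp
  with e that show ?thesis by blast
qed

text \<open>With \<open>D = B - C\<close> one has \<open>B D + D C = B\<^sup>2 - C\<^sup>2 = 0\<close>; testing this on an eigenvector of \<open>D\<close>
  in its range shows that the eigenvalue vanishes.\<close>

lemma nonneg_definite_sqrt_unique:
  fixes B C :: "real ^ 'n ^ 'n"
  assumes B: "nonneg_definite B" and C: "nonneg_definite C" and eq: "B ** B = C ** C"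
  shows "B = C"
proof (rule ccontr)
  assume "B \<noteq> C"
  define D where "D = B - C"
  have D: "D *v x = B *v x - C *v x" for x
    by (simp add: D_def matrix_vector_mult_diff_rdistrib)
  have symB: "(B *v x) \<bullet> y = x \<bullet> (B *v y)" and symC: "(C *v x) \<bullet> y = x \<bullet> (C *v y)" for x y
    using B C by (auto simp: nonneg_definite_def symmetric_matrix_inner)
  have symD: "transpose D = D"
    by (rule symmetric_matrixI) (simp add: D inner_diff_left inner_diff_right symB symC)
  have BC: "B *v (B *v x) = C *v (C *v x)" for x
    using eq by (simp add: matrix_vector_mul_assoc)
  have "subspace (range (\<lambda>x. D *v x))"
    by (simp add: linear_subspace_image)
  moreover have "range (\<lambda>x. D *v x) \<noteq> {0}"
  proof
    assume "range (\<lambda>x. D *v x) = {0}"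
    then have "D *v x = 0" for x by blast
    then show False using \<open>B \<noteq> C\<close> by (simp add: D matrix_eq)
  qed
  ultimately obtain e l where e: "e \<in> range (\<lambda>x. D *v x)" "norm e = 1" "D *v e = l *\<^sub>R e"
    using symmetric_matrix_eigenvector[OF symD] by blast
  obtain z where z: "e = D *v z" using e(1) by blast
  \<comment> \<open>For symmetric \<open>D\<close> the kernel is orthogonal to the range, and
    \<open>e\<close> is a unit vector in the range.\<close>
  have "l \<noteq> 0"
  proof
    assume "l = 0"
    then have "e \<bullet> e = 0"
      using e(3) symmetric_matrix_inner[OF symD, of e z] z by simp
    then show False using e(2) by simp
  qed
  have "e \<bullet> (B *v (D *v e)) + e \<bullet> (D *v (C *v e)) = 0"
    by (simp add: D matrix_vector_mult_diff_distrib inner_diff_right BC)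
  then have "l * (e \<bullet> (B *v e) + e \<bullet> (C *v e)) = 0"
    using symmetric_matrix_inner[OF symD, of e "C *v e"]
    by (simp add: e(3) matrix_vector_mult_scaleR algebra_simps)
  then have "e \<bullet> (B *v e) + e \<bullet> (C *v e) = 0"
    using \<open>l \<noteq> 0\<close> by simp
  moreover have "0 \<le> e \<bullet> (B *v e)" "0 \<le> e \<bullet> (C *v e)"
    using B C by (auto simp: nonneg_definite_def)
  ultimately have "e \<bullet> (D *v e) = 0"
    by (simp add: D inner_diff_right)
  then show False
    using e \<open>l \<noteq> 0\<close> by (simp add: norm_eq_1)
qed

text \<open>Induction on \<open>dim S\<close>: split off an eigenvector \<open>e\<close> and take
  the root on its orthogonal complement within \<open>S\<close>. The last conjunct makes that
  smaller root annihilate \<open>e\<close>, so that the two pieces do not interact.\<close>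

lemma nonneg_definite_sqrt_on_subspace:
  fixes A :: "real ^ 'n ^ 'n"
  assumes A: "nonneg_definite A"
    and "subspace S" "\<And>x. x \<in> S \<Longrightarrow> A *v x \<in> S"
  shows "\<exists>B. nonneg_definite B \<and> (\<forall>x\<in>S. B *v x \<in> S \<and> B *v (B *v x) = A *v x) \<and>
    (\<forall>x. (\<forall>y\<in>S. y \<bullet> x = 0) \<longrightarrow> B *v x = 0)"
  using assms(2,3)
proof (induction "dim S" arbitrary: S rule: less_induct)
  case less
  note S = \<open>subspace S\<close> and inv = less.prems(2)
  show ?case
  proof (cases "S = {0}")
    case True
    have "nonneg_definite (0 :: real ^ 'n ^ 'n)"
      by (auto simp: nonneg_definite_def intro: symmetric_matrixI)
    with True show ?thesis
      by (intro exI[of _ 0]) auto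
  next
    case False
    have symA: "transpose A = A" using A by (simp add: nonneg_definite_def)
    obtain e l where e: "e \<in> S" "norm e = 1" "A *v e = l *\<^sub>R e"
      using symmetric_matrix_eigenvector[OF symA S False inv] by blast
    have ee: "e \<bullet> e = 1" using e(2) by (simp add: norm_eq_1)
    have "0 \<le> e \<bullet> (A *v e)" using A by (simp add: nonneg_definite_def)
    then have l: "0 \<le> l" by (simp add: e(3) ee)
    define S' where "S' = S \<inter> {x. e \<bullet> x = 0}"
    have S': "subspace S'"
      unfolding S'_def by (intro subspace_inter S subspace_hyperplane)
    have "e \<notin> S'" by (simp add: S'_def ee)
    then have "S' \<subset> S" using e(1) unfolding S'_def by blast
    moreover have "span S' = S'" "span S = S"
      using S S' by (simp_all only: span_eq_iff)
    ultimately have "dim S' < dim S"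
      by (intro dim_psubset) (simp only:)
    moreover have inv': "A *v x \<in> S'" if "x \<in> S'" for x
      using that inv symmetric_matrix_inner[OF symA, of e x] by (auto simp: S'_def e(3))
    ultimately obtain B where B: "nonneg_definite B"
      and BS: "\<And>x. x \<in> S' \<Longrightarrow> B *v x \<in> S'" "\<And>x. x \<in> S' \<Longrightarrow> B *v (B *v x) = A *v x"
      and B0: "\<And>x. (\<And>y. y \<in> S' \<Longrightarrow> y \<bullet> x = 0) \<Longrightarrow> B *v x = 0"
      using less.hyps[OF _ S' inv'] by metis
    have Be: "B *v e = 0"
      by (rule B0) (auto simp: S'_def inner_commute)
    have symB: "(B *v x) \<bullet> y = x \<bullet> (B *v y)" for x y
      using B by (simp add: nonneg_definite_def symmetric_matrix_inner)
    have eB: "e \<bullet> (B *v x) = 0" for x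
      using symB[of e x] Be by simp
    \<comment> \<open>The added rank-one piece multiplies \<open>e\<close> by \<open>sqrt l\<close>;
      here \<open>l \<ge> 0\<close> because \<open>A\<close> is non-negative definite.\<close>
    define B' where "B' = matrix (\<lambda>x. B *v x + (sqrt l * (e \<bullet> x)) *\<^sub>R e)"
    have B': "B' *v x = B *v x + (sqrt l * (e \<bullet> x)) *\<^sub>R e" for x
    proof -
      have "linear (\<lambda>x. B *v x + (sqrt l * (e \<bullet> x)) *\<^sub>R e)"
        by (rule linearI) (simp_all add: matrix_vector_right_distrib matrix_vector_mult_scaleR inner_add_right
            distrib_left scaleR_add_left scaleR_add_right mult.left_commute)
      then have "(\<lambda>x. B' *v x) = (\<lambda>x. B *v x + (sqrt l * (e \<bullet> x)) *\<^sub>R e)"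
        unfolding B'_def by (rule matrix_vector_mul(2))
      then show ?thesis by meson
    qed
    have "nonneg_definite B'"
      unfolding nonneg_definite_def
    proof
      show "transpose B' = B'"
        by (rule symmetric_matrixI)
          (simp add: B' inner_add_left inner_add_right symB inner_commute[of _ e])
      have "0 \<le> x \<bullet> (B *v x) + sqrt l * (e \<bullet> x)\<^sup>2" for x
        using B l by (simp add: nonneg_definite_def)
      then show "\<forall>x. 0 \<le> x \<bullet> (B' *v x)"
        by (simp add: B' inner_add_right inner_commute power2_eq_square mult_ac)
    qed
    moreover have "B' *v x \<in> S \<and> B' *v (B' *v x) = A *v x" if "x \<in> S" for x
    proof -
      define y where "y = x - (e \<bullet> x) *\<^sub>R e"
      have y: "y \<in> S'"
        using that e(1) S by (simp add: y_def S'_def subspace_diff subspace_scale inner_diff_right ee)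
      have Bx: "B *v x = B *v y"
        using Be by (simp add: y_def matrix_vector_mult_diff_distrib matrix_vector_mult_scaleR)
      have "B *v y \<in> S" using BS(1)[OF y] by (simp add: S'_def)
      then have "B' *v x \<in> S"
        using e(1) S by (simp add: B' Bx subspace_add subspace_scale)
      moreover have "B' *v (B' *v x) = A *v y + (l * (e \<bullet> x)) *\<^sub>R e"
      proof -
        have "sqrt l * (sqrt l * (e \<bullet> x)) = l * (e \<bullet> x)"
          using l by (simp add: mult.assoc[symmetric])
        then show ?thesis
          by (simp add: B' Bx matrix_vector_right_distrib matrix_vector_mult_scaleR Be
              inner_add_right eB ee BS(2)[OF y])
      qed
      moreover have "A *v x = A *v y + (l * (e \<bullet> x)) *\<^sub>R e"
        by (simp add: y_def matrix_vector_mult_diff_distrib matrix_vector_mult_scaleR e(3) mult.commute)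
      ultimately show ?thesis by simp
    qed
    moreover have "B' *v x = 0" if "\<forall>y\<in>S. y \<bullet> x = 0" for x
      using B0[of x] that e(1) by (auto simp: B' S'_def)
    ultimately show ?thesis by blast
  qed
qed

lemma matrix_sqrt:
  fixes A :: "real ^ 'n ^ 'n"
  assumes "nonneg_definite A"
  shows "nonneg_definite (matrix_sqrt A)" and "matrix_sqrt A ** matrix_sqrt A = A"
proof -
  obtain B where B: "nonneg_definite B" "\<And>x. B *v (B *v x) = A *v x"
    using nonneg_definite_sqrt_on_subspace[OF assms, of UNIV] by auto
  have "B ** B = A"
    using B(2) by (simp add: matrix_eq matrix_vector_mul_assoc)
  then have "nonneg_definite (matrix_sqrt A) \<and> matrix_sqrt A ** matrix_sqrt A = A"
    unfolding matrix_sqrt_def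
    by (intro theI[of "\<lambda>B. nonneg_definite B \<and> B ** B = A" B])
      (simp_all add: B(1) nonneg_definite_sqrt_unique)
  then show "nonneg_definite (matrix_sqrt A)" "matrix_sqrt A ** matrix_sqrt A = A" by auto
qed

text \<open>Whatever depends on the square root only through norms and inner products is thereby
  expressed by the quadratic form of \<open>A\<close>.\<close>

lemma inner_matrix_sqrt:
  fixes A :: "real ^ 'n ^ 'n"
  assumes "nonneg_definite A"
  shows "(matrix_sqrt A *v x) \<bullet> (matrix_sqrt A *v y) = x \<bullet> (A *v y)"
proof -
  have "transpose (matrix_sqrt A) = matrix_sqrt A"
    using matrix_sqrt(1)[OF assms] by (simp add: nonneg_definite_def)
  from symmetric_matrix_inner[OF this] show ?thesis
    by (simp add: matrix_vector_mul_assoc matrix_sqrt(2)[OF assms])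
qed

lemma norm_matrix_sqrt:
  fixes A :: "real ^ 'n ^ 'n"
  assumes "nonneg_definite A"
  shows "norm (matrix_sqrt A *v x) = sqrt (x \<bullet> (A *v x))"
  unfolding norm_eq_sqrt_inner inner_matrix_sqrt[OF assms] ..

lemma norm_matrix_sqrt_le:
  fixes A :: "real ^ 'n ^ 'n"
  assumes "nonneg_definite A"
  shows "norm (matrix_sqrt A *v x) \<le> sqrt (op_norm A) * norm x"
proof -
  have "norm (A *v x) \<le> op_norm A * norm x"
    unfolding op_norm_def by (rule onorm) (rule matrix_vector_mul_bounded_linear)
  then have "norm x * norm (A *v x) \<le> norm x * (op_norm A * norm x)"
    by (rule mult_left_mono) simp
  then have "x \<bullet> (A *v x) \<le> op_norm A * (norm x)\<^sup>2"
    using norm_cauchy_schwarz[of x "A *v x"] by (simp add: power2_eq_square mult_ac)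
  then have "sqrt (x \<bullet> (A *v x)) \<le> sqrt (op_norm A * (norm x)\<^sup>2)" by simp
  then show ?thesis by (simp add: norm_matrix_sqrt[OF assms] real_sqrt_mult)
qed

lemma op_norm_nonneg: "0 \<le> op_norm A"
  unfolding op_norm_def by (rule onorm_pos_le) (rule matrix_vector_mul_bounded_linear)

section \<open>Gradients of Lipschitz functions\<close>

lemma grad_eq:
  assumes "GDERIV \<phi> x :> D"
  shows "grad \<phi> x = D"
proof -
  have "D' = D" if "GDERIV \<phi> x :> D'" for D'
  proof -
    have "(\<lambda>h. h \<bullet> D') = (\<lambda>h. h \<bullet> D)"
      using that assms unfolding gderiv_def by (rule has_derivative_unique)
    from fun_cong[OF this, of "D' - D"] have "(D' - D) \<bullet> (D' - D) = 0"
      by (simp only: inner_diff_right)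
    then show ?thesis by simp
  qed
  then have "(THE D. GDERIV \<phi> x :> D) = D"
    using assms by blast
  then show ?thesis
    using assms unfolding grad_def by auto
qed

text \<open>The formula also holds where \<open>\<phi>\<close> is not differentiable: by Caratheodory's
  characterisation and \<open>F' \<noteq> 0\<close>, differentiability of \<open>F \<circ> \<phi>\<close> at \<open>x\<close> implies that of \<open>\<phi>\<close>, so
  both sides take the default value 0. This is why Rademacher's theorem is never needed.\<close>

lemma grad_compose:
  fixes \<phi> :: "real ^ 'n \<Rightarrow> real"
  assumes cont: "isCont \<phi> x" and F: "DERIV F (\<phi> x) :> d" and d: "d \<noteq> 0"
  shows "grad (\<lambda>y. F (\<phi> y)) x = d *\<^sub>R grad \<phi> x"
proof (cases "\<exists>D. GDERIV \<phi> x :> D")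
  case True
  then obtain D where D: "GDERIV \<phi> x :> D" by blast
  from grad_eq[OF GDERIV_DERIV_compose[OF this F]] grad_eq[OF D] show ?thesis by simp
next
  case False
  have "\<nexists>E. GDERIV (\<lambda>y. F (\<phi> y)) x :> E"
  proof
    assume "\<exists>E. GDERIV (\<lambda>y. F (\<phi> y)) x :> E"
    then obtain E where E: "((\<lambda>y. F (\<phi> y)) has_derivative (\<lambda>h. h \<bullet> E)) (at x)"
      unfolding gderiv_def by blast
    obtain q where q: "\<And>z. F z - F (\<phi> x) = q z * (z - \<phi> x)" "isCont q (\<phi> x)" "q (\<phi> x) = d"
      using F unfolding CARAT_DERIV by blast
    \<comment> \<open>The reciprocal slope: near \<open>x\<close> it satisfies
      \<open>r y * (F (\<phi> y) - F (\<phi> x)) = \<phi> y - \<phi> x\<close>, and it is continuous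
      at \<open>x\<close> because \<open>q (\<phi> x) = d \<noteq> 0\<close>.\<close>
    define r where "r y = inverse (q (\<phi> y))" for y
    have cq: "isCont (\<lambda>y. q (\<phi> y)) x"
      using cont q(2) by (rule isCont_o2)
    then have cr: "isCont r x"
      unfolding r_def using d q(3) by (intro continuous_intros) auto
    have ev: "eventually (\<lambda>y. q (\<phi> y) \<noteq> 0) (at x)"
      using cq d q(3) unfolding isCont_def by (intro tendsto_imp_eventually_ne) auto
    \<comment> \<open>The sum is the remainder quotient of \<open>\<phi>\<close> for the candidate
      gradient \<open>r x *\<^sub>R E\<close>: its first term is \<open>r y\<close> times the
      remainder quotient of \<open>F \<circ> \<phi>\<close>, its second is at most
      \<open>\<bar>r y - r x\<bar> * norm E\<close>.\<close>
    have "((\<lambda>y. r y * (((F (\<phi> y) - F (\<phi> x)) - (y - x) \<bullet> E) /\<^sub>R norm (y - x))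
        + (r y - r x) * (((y - x) \<bullet> E) /\<^sub>R norm (y - x))) \<longlongrightarrow> r x * 0 + 0) (at x)"
    proof (intro tendsto_add tendsto_mult)
      show "(r \<longlongrightarrow> r x) (at x)" using cr by (simp add: isCont_def)
      show "((\<lambda>y. ((F (\<phi> y) - F (\<phi> x)) - (y - x) \<bullet> E) /\<^sub>R norm (y - x)) \<longlongrightarrow> 0) (at x)"
        using E unfolding has_derivative_at_within by blast
      have "((\<lambda>y. \<bar>r y - r x\<bar> * norm E) \<longlongrightarrow> \<bar>r x - r x\<bar> * norm E) (at x)"
        using cr unfolding isCont_def by (intro tendsto_intros)
      then have lim: "((\<lambda>y. \<bar>r y - r x\<bar> * norm E) \<longlongrightarrow> 0) (at x)" by simp
      have "norm ((r y - r x) * (((y - x) \<bullet> E) /\<^sub>R norm (y - x))) \<le> \<bar>r y - r x\<bar> * norm E" for y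
      proof -
        have "\<bar>((y - x) \<bullet> E) /\<^sub>R norm (y - x)\<bar> \<le> norm E"
          using Cauchy_Schwarz_ineq2[of "y - x" E]
          by (cases "y = x") (simp_all add: abs_mult divide_simps mult.commute)
        then have "\<bar>r y - r x\<bar> * \<bar>((y - x) \<bullet> E) /\<^sub>R norm (y - x)\<bar> \<le> \<bar>r y - r x\<bar> * norm E"
          by (rule mult_left_mono) simp
        then show ?thesis by (simp only: real_norm_def abs_mult)
      qed
      then show "((\<lambda>y. (r y - r x) * (((y - x) \<bullet> E) /\<^sub>R norm (y - x))) \<longlongrightarrow> 0) (at x)"
        by (intro Lim_null_comparison[OF always_eventually lim]) blast
    qed
    moreover have "eventually (\<lambda>y. r y * (((F (\<phi> y) - F (\<phi> x)) - (y - x) \<bullet> E) /\<^sub>R norm (y - x))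
        + (r y - r x) * (((y - x) \<bullet> E) /\<^sub>R norm (y - x))
        = ((\<phi> y - \<phi> x) - (y - x) \<bullet> (r x *\<^sub>R E)) /\<^sub>R norm (y - x)) (at x)"
      using ev
    proof eventually_elim
      case (elim y)
      then have "r y * (F (\<phi> y) - F (\<phi> x)) = \<phi> y - \<phi> x"
        by (simp add: q(1) r_def)
      moreover have "r y * (((F (\<phi> y) - F (\<phi> x)) - (y - x) \<bullet> E) /\<^sub>R norm (y - x))
        + (r y - r x) * (((y - x) \<bullet> E) /\<^sub>R norm (y - x))
        = (r y * (F (\<phi> y) - F (\<phi> x)) - r x * ((y - x) \<bullet> E)) /\<^sub>R norm (y - x)"
        by (simp add: algebra_simps)
      ultimately show ?case by simp
    qed
    ultimately have "((\<lambda>y. ((\<phi> y - \<phi> x) - (y - x) \<bullet> (r x *\<^sub>R E)) /\<^sub>R norm (y - x)) \<longlongrightarrow> 0) (at x)"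
      by (simp add: tendsto_cong)
    then have "GDERIV \<phi> x :> r x *\<^sub>R E"
      unfolding gderiv_def has_derivative_at_within
      by (intro conjI bounded_linear_inner_left)
    with False show False by blast
  qed
  with False show ?thesis by (simp add: grad_def)
qed

section \<open>Support and size of the gradient\<close>

lemma grad_eq_0:
  fixes \<phi> :: "real ^ 'n \<Rightarrow> real"
  assumes "x \<notin> closure {x. \<phi> x \<noteq> 0}"
  shows "grad \<phi> x = 0"
proof -
  have "((\<lambda>x. 0) has_derivative (\<lambda>h. h \<bullet> 0)) (at x)" by simp
  then have "(\<phi> has_derivative (\<lambda>h. h \<bullet> 0)) (at x)"
  proof (rule has_derivative_transform_within_open)
    show "open (- closure {x. \<phi> x \<noteq> 0})" by (rule open_Compl) (rule closed_closure)
    show "x \<in> - closure {x. \<phi> x \<noteq> 0}" using assms by simp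
    show "0 = \<phi> y" if "y \<in> - closure {x. \<phi> x \<noteq> 0}" for y
      using that closure_subset[of "{x. \<phi> x \<noteq> 0}"] by auto
  qed
  then show ?thesis by (intro grad_eq) (simp add: gderiv_def)
qed

text \<open>A step \<open>t *\<^sub>R D\<close> along the gradient changes \<open>\<phi>\<close> by
  about \<open>t * (D \<bullet> D)\<close>, but by at most \<open>L * (t * norm D)\<close>. Where no
  gradient exists, the default value 0 satisfies the bound.\<close>

lemma norm_grad_le:
  fixes \<phi> :: "real ^ 'n \<Rightarrow> real"
  assumes lip: "L-lipschitz_on S \<phi>" and S: "open S" "x \<in> S"
  shows "norm (grad \<phi> x) \<le> L"
proof (cases "\<exists>D. GDERIV \<phi> x :> D")
  case False
  then have "grad \<phi> x = 0" by (auto simp: grad_def)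
  with lip show ?thesis by (simp add: lipschitz_on_nonneg)
next
  case True
  then obtain D where D: "GDERIV \<phi> x :> D" by blast
  have "norm D \<le> L"
  proof (rule field_le_epsilon)
    fix e :: real assume "e > 0"
    then obtain d where d: "d > 0"
      and der: "\<And>y. norm (y - x) < d \<Longrightarrow> \<bar>\<phi> y - \<phi> x - (y - x) \<bullet> D\<bar> \<le> e * norm (y - x)"
      using D unfolding gderiv_def has_derivative_at_alt real_norm_def by blast
    obtain c where c: "c > 0" "ball x c \<subseteq> S"
      using S openE by blast
    \<comment> \<open>The step stays within the ball of radius \<open>c\<close> inside
      \<open>S\<close> and within the distance \<open>d\<close> where \<open>der\<close> holds; the
      summand 1 avoids division by 0 when \<open>D = 0\<close>.\<close>
    define t where "t = min c d / 2 / (norm D + 1)"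
    have D1: "0 < norm D + 1" by (rule add_nonneg_pos) auto
    have t: "t > 0" using c(1) d D1 by (simp add: t_def)
    have "t * norm D < min c d"
    proof -
      have "t * norm D \<le> t * (norm D + 1)" using t by (intro mult_left_mono) auto
      also have "\<dots> = min c d / 2"
        by (rule nonzero_eq_divide_eq[THEN iffD1, OF _ t_def]) (use D1 in simp)
      also have "\<dots> < min c d" using c(1) d by (auto simp: min_def)
      finally show ?thesis .
    qed
    then have small: "norm (t *\<^sub>R D) < c" "norm (t *\<^sub>R D) < d" using t by auto
    have "x + t *\<^sub>R D \<in> S" using small(1) c(2) by (auto simp: dist_norm)
    then have "\<bar>\<phi> (x + t *\<^sub>R D) - \<phi> x\<bar> \<le> L * (t * norm D)"
      using lipschitz_onD[OF lip, of "x + t *\<^sub>R D" x] S t by (simp add: dist_norm)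
    moreover have "\<bar>\<phi> (x + t *\<^sub>R D) - \<phi> x - t * (D \<bullet> D)\<bar> \<le> e * (t * norm D)"
      using der[of "x + t *\<^sub>R D"] small(2) t by simp
    ultimately have "t * (D \<bullet> D) \<le> L * (t * norm D) + e * (t * norm D)" by linarith
    then have "t * (norm D * norm D) \<le> t * ((L + e) * norm D)"
      by (simp add: algebra_simps power2_norm_eq_inner[symmetric] power2_eq_square)
    then have "norm D * norm D \<le> (L + e) * norm D" using t by simp
    then show "norm D \<le> L + e"
      using lipschitz_on_nonneg[OF lip] \<open>e > 0\<close> by (cases "D = 0") auto
  qed
  with grad_eq[OF D] show ?thesis by simp
qed

section \<open>Borel measurability of the gradient\<close>

lemma GDERIV_difference_quotients:
  fixes \<phi> :: "real ^ 'n \<Rightarrow> real"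
  assumes "GDERIV \<phi> x :> D"
  shows "(\<lambda>n. real (Suc n) * (\<phi> (x + b /\<^sub>R real (Suc n)) - \<phi> x)) \<longlonglongrightarrow> b \<bullet> D"
proof -
  have "((\<lambda>t. x + t *\<^sub>R b) has_derivative (\<lambda>t. t *\<^sub>R b)) (at 0)"
    by (auto intro!: derivative_eq_intros)
  moreover have "(\<phi> has_derivative (\<lambda>h. h \<bullet> D)) (at (x + 0 *\<^sub>R b))"
    using assms by (simp add: gderiv_def)
  ultimately have "((\<lambda>t. \<phi> (x + t *\<^sub>R b)) has_derivative (\<lambda>t. (t *\<^sub>R b) \<bullet> D)) (at 0)"
    by (rule has_derivative_compose)
  then have "((\<lambda>t. \<phi> (x + t *\<^sub>R b)) has_real_derivative (b \<bullet> D)) (at 0)"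
    unfolding has_field_derivative_def by (simp add: mult.commute[of _ "b \<bullet> D"])
  then have "(\<lambda>t. (\<phi> (x + t *\<^sub>R b) - \<phi> x) / t) \<midarrow>0\<rightarrow> b \<bullet> D"
    unfolding DERIV_def by simp
  moreover have "filterlim (\<lambda>n. inverse (real (Suc n))) (at 0) sequentially"
    using LIMSEQ_inverse_real_of_nat by (intro filterlim_atI) auto
  ultimately have "(\<lambda>n. (\<phi> (x + inverse (real (Suc n)) *\<^sub>R b) - \<phi> x) / inverse (real (Suc n))) \<longlonglongrightarrow> b \<bullet> D"
    by (rule filterlim_compose)
  then show ?thesis by (simp add: divide_inverse mult.commute)
qed

text \<open>The only candidate for the gradient is the limit \<open>G\<close> of difference quotients along the axes,
  and by continuity it suffices to test differentiability on a countable dense set of increments.\<close>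

lemma borel_measurable_grad:
  fixes \<phi> :: "real ^ 'n \<Rightarrow> real"
  assumes cont: "continuous_on UNIV \<phi>"
  shows "grad \<phi> \<in> borel_measurable borel"
proof -
  have phi[measurable]: "\<phi> \<in> borel_measurable borel"
    using cont by (rule borel_measurable_continuous_onI)
  define G where "G x = (\<Sum>b\<in>Basis. lim (\<lambda>n. real (Suc n) * (\<phi> (x + b /\<^sub>R real (Suc n)) - \<phi> x)) *\<^sub>R b)"
    for x
  have G[measurable]: "G \<in> borel_measurable borel"
    unfolding G_def by measurable
  have G_eq: "G x = D" if "GDERIV \<phi> x :> D" for x D
    unfolding G_def limI[OF GDERIV_difference_quotients[OF that]]
    by (subst inner_commute) (rule euclidean_representation)
  obtain T :: "(real ^ 'n) set" where T: "countable T"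
    and dense: "\<And>X. open X \<Longrightarrow> X \<noteq> {} \<Longrightarrow> \<exists>d \<in> T. d \<in> X"
    using countable_dense_setE by blast
  \<comment> \<open>Differentiability with gradient \<open>G x\<close>, written with countable
    quantifiers only, so that it cuts out a Borel set.\<close>
  define P where "P x \<longleftrightarrow> (\<forall>k::nat. \<exists>m::nat. \<forall>h\<in>T. norm h < inverse (real (Suc m)) \<longrightarrow>
      \<bar>\<phi> (x + h) - \<phi> x - h \<bullet> G x\<bar> \<le> inverse (real (Suc k)) * norm h)" for x
  have P[measurable]: "Measurable.pred borel P"
    unfolding P_def using T by measurable
  have P_iff: "P x \<longleftrightarrow> GDERIV \<phi> x :> G x" for x
  proof
    assume P: "P x"
    show "GDERIV \<phi> x :> G x"
      unfolding gderiv_def has_derivative_at_alt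
    proof (intro conjI allI impI bounded_linear_inner_left)
      fix e :: real assume "e > 0"
      then obtain k where k: "inverse (real (Suc k)) < e"
        using reals_Archimedean by blast
      from P obtain m where m: "\<And>h. h \<in> T \<Longrightarrow> norm h < inverse (real (Suc m)) \<Longrightarrow>
          \<bar>\<phi> (x + h) - \<phi> x - h \<bullet> G x\<bar> \<le> inverse (real (Suc k)) * norm h"
        unfolding P_def by blast
      have *: "\<bar>\<phi> (x + h) - \<phi> x - h \<bullet> G x\<bar> \<le> inverse (real (Suc k)) * norm h"
        if h: "norm h < inverse (real (Suc m))" for h
      proof (rule ccontr)
        define X where "X = ball 0 (inverse (real (Suc m))) \<inter>
          {h. inverse (real (Suc k)) * norm h < \<bar>\<phi> (x + h) - \<phi> x - h \<bullet> G x\<bar>}"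
        assume "\<not> \<bar>\<phi> (x + h) - \<phi> x - h \<bullet> G x\<bar> \<le> inverse (real (Suc k)) * norm h"
        then have "X \<noteq> {}" using h unfolding X_def by (auto intro!: exI[of _ h])
        moreover have "open X"
          unfolding X_def
          by (intro open_Int open_ball open_Collect_less continuous_intros
              continuous_on_compose2[OF cont]) auto
        ultimately obtain h' where "h' \<in> T" "h' \<in> X" using dense by blast
        with m[of h'] show False by (auto simp: X_def)
      qed
      show "\<exists>d>0. \<forall>y. norm (y - x) < d \<longrightarrow> norm (\<phi> y - \<phi> x - (y - x) \<bullet> G x) \<le> e * norm (y - x)"
      proof (intro exI[of _ "inverse (real (Suc m))"] conjI allI impI)
        fix y assume "norm (y - x) < inverse (real (Suc m))"
        from *[OF this] show "norm (\<phi> y - \<phi> x - (y - x) \<bullet> G x) \<le> e * norm (y - x)"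
          using mult_right_mono[OF less_imp_le[OF k], of "norm (y - x)"] by simp
      qed simp
    qed
  next
    assume "GDERIV \<phi> x :> G x"
    then have D: "\<exists>d>0. \<forall>y. norm (y - x) < d \<longrightarrow> norm (\<phi> y - \<phi> x - (y - x) \<bullet> G x) \<le> e * norm (y - x)"
      if "e > 0" for e
      using that unfolding gderiv_def has_derivative_at_alt by blast
    show "P x"
      unfolding P_def
    proof
      fix k :: nat
      obtain d where d: "d > 0" "\<And>y. norm (y - x) < d \<Longrightarrow>
          norm (\<phi> y - \<phi> x - (y - x) \<bullet> G x) \<le> inverse (real (Suc k)) * norm (y - x)"
        using D[of "inverse (real (Suc k))"] by auto
      obtain m where m: "inverse (real (Suc m)) < d"
        using reals_Archimedean[OF d(1)] by blast
      show "\<exists>m. \<forall>h\<in>T. norm h < inverse (real (Suc m)) \<longrightarrow>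
          \<bar>\<phi> (x + h) - \<phi> x - h \<bullet> G x\<bar> \<le> inverse (real (Suc k)) * norm h"
        using d(2)[of "x + h" for h] m by (intro exI[of _ m]) auto
    qed
  qed
  have "grad \<phi> = (\<lambda>x. if P x then G x else 0)"
  proof
    fix x
    show "grad \<phi> x = (if P x then G x else 0)"
    proof (cases "P x")
      case True
      then show ?thesis using P_iff grad_eq by auto
    next
      case False
      then have "\<nexists>D. GDERIV \<phi> x :> D" using P_iff G_eq by metis
      then show ?thesis using False by (simp add: grad_def)
    qed
  qed
  also have "\<dots> \<in> borel_measurable borel" by measurable
  finally show ?thesis .
qed

text \<open>The Lipschitz bound gives continuity on \<open>\<Omega>\<close>, and
  \<open>\<phi>\<close> is 0 on the complement of its closed support. These two open sets cover the
  whole space.\<close>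

lemma Lip0_continuous:
  assumes "\<phi> \<in> Lip0 \<Omega>" "open \<Omega>"
  shows "continuous_on UNIV \<phi>"
proof -
  define S where "S = closure {x. \<phi> x \<noteq> 0}"
  have S: "closed S" "S \<subseteq> \<Omega>" and lip: "\<exists>L. L-lipschitz_on \<Omega> \<phi>"
    using assms(1) by (auto simp: S_def Lip0_def)
  have zero: "\<phi> x = 0" if "x \<in> - S" for x
    using that closure_subset[of "{x. \<phi> x \<noteq> 0}"] by (auto simp: S_def)
  have "continuous_on \<Omega> \<phi>"
    using lip lipschitz_on_continuous_on by blast
  moreover have "continuous_on (- S) \<phi>"
    by (rule continuous_on_eq[OF continuous_on_const[of _ 0]]) (rule zero[symmetric])
  ultimately have "continuous_on (\<Omega> \<union> - S) \<phi>"
    using assms(2) S(1) by (intro continuous_on_open_Un) auto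
  moreover have "\<Omega> \<union> - S = UNIV" using S(2) by blast
  ultimately show ?thesis by simp
qed

text \<open>A bounded derivative makes \<open>F\<close> Lipschitz, and \<open>F 0 = 0\<close> keeps
  the support from growing. This is the source of the test functions used below.\<close>

lemma Lip0_compose:
  assumes \<phi>: "\<phi> \<in> Lip0 \<Omega>"
    and F: "\<And>t. (F has_real_derivative F' t) (at t)" "\<And>t. \<bar>F' t\<bar> \<le> B" "F 0 = 0"
  shows "(\<lambda>x. F (\<phi> x)) \<in> Lip0 \<Omega>"
proof -
  obtain L where L: "L-lipschitz_on \<Omega> \<phi>" using \<phi> by (auto simp: Lip0_def)
  have "\<bar>F s - F t\<bar> \<le> B * \<bar>s - t\<bar>" for s t
    using field_differentiable_bound[of UNIV F F' B s t] F by simp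
  then have "B-lipschitz_on (\<phi> ` \<Omega>) F"
    using F(2)[of 0] by (intro lipschitz_onI) (auto simp: dist_real_def)
  then have "(B * L)-lipschitz_on \<Omega> (\<lambda>x. F (\<phi> x))"
    using lipschitz_on_compose2[OF L] by blast
  moreover have sub: "closure {x. F (\<phi> x) \<noteq> 0} \<subseteq> closure {x. \<phi> x \<noteq> 0}"
    using F(3) by (intro closure_mono) auto
  moreover have "compact (closure {x. F (\<phi> x) \<noteq> 0})"
    using compact_Int_closed[of "closure {x. \<phi> x \<noteq> 0}" "closure {x. F (\<phi> x) \<noteq> 0}"] sub \<phi>
    by (auto simp: Lip0_def Int_absorb1)
  ultimately show ?thesis using \<phi> by (auto simp: Lip0_def)
qed

section \<open>Integration\<close>

lemma Lp_loc_integrable: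
  assumes "h \<in> Lp_loc r \<Omega>" "open \<Omega>" "compact K" "K \<subseteq> \<Omega>"
  shows "integrable (lebesgue_on \<Omega>) (\<lambda>x. indicat_real K x * \<bar>h x\<bar> powr r)"
proof -
  have K: "K \<in> sets lebesgue" "\<Omega> \<in> sets lebesgue"
    using assms(2,3) by (auto simp: compact_imp_closed)
  have "integrable (lebesgue_on K) (\<lambda>x. \<bar>h x\<bar> powr r)"
    using assms by (auto simp: Lp_loc_def)
  then have "integrable lebesgue (\<lambda>x. indicat_real K x *\<^sub>R \<bar>h x\<bar> powr r)"
    using K by (subst (asm) integrable_restrict_space) auto
  moreover have "(\<lambda>x. indicat_real K x *\<^sub>R \<bar>h x\<bar> powr r) =
      (\<lambda>x. indicat_real \<Omega> x *\<^sub>R (indicat_real K x * \<bar>h x\<bar> powr r))"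
    using assms(4) by (intro ext) (auto simp: indicator_def)
  ultimately show ?thesis
    using K by (subst integrable_restrict_space) auto
qed

lemma borel_measurable_lebesgue_on:
  "f \<in> borel_measurable borel \<Longrightarrow> f \<in> borel_measurable (lebesgue_on S)"
  by (intro measurable_restrict_space1 measurable_completion) simp

lemma borel_measurable_vec_component:
  fixes h :: "'a \<Rightarrow> 'b::{second_countable_topology, real_normed_vector} ^ 'n"
  assumes "h \<in> borel_measurable N"
  shows "(\<lambda>x. h x $ i) \<in> borel_measurable N"
proof -
  have "(\<lambda>y :: 'b ^ 'n. y $ i) \<in> borel_measurable borel"
    by (intro borel_measurable_continuous_onI continuous_intros)
  with assms show ?thesis by (rule measurable_compose)
qed

text \<open>Follows from \<open>a + b \<le> 2 * max a b\<close>, and stands in for the triangle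
  inequality at the level of \<open>p\<close>-th powers.\<close>

lemma powr_add_le:
  fixes a b p :: real
  assumes "0 \<le> a" "0 \<le> b" "0 \<le> p"
  shows "(a + b) powr p \<le> 2 powr p * (a powr p + b powr p)"
proof -
  have "(a + b) powr p \<le> (2 * max a b) powr p"
    using assms by (intro powr_mono2) auto
  also have "\<dots> = 2 powr p * max a b powr p"
    using assms by (simp add: powr_mult)
  also have "max a b powr p \<le> a powr p + b powr p"
    by (auto simp: max_def)
  finally show ?thesis by simp
qed

text \<open>If \<open>b \<le> a / 2\<close>, the product is at most half of \<open>a powr p\<close>;
  otherwise \<open>a < 2 * b\<close>. The coefficient 1/2 is what lets the energy be absorbed in
  \<open>energy_estimate\<close>.\<close>

lemma powr_absorb:
  fixes a b p :: real
  assumes "0 \<le> a" "0 \<le> b" "1 < p"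
  shows "a powr (p - 1) * b \<le> a powr p / 2 + 2 powr (p - 1) * b powr p"
proof -
  have mult: "t powr (p - 1) * t = t powr p" if "0 \<le> t" for t :: real
    using that by (cases "t = 0") (simp_all add: powr_diff)
  show ?thesis
  proof (cases "b \<le> a / 2")
    case True
    then have "a powr (p - 1) * b \<le> a powr (p - 1) * (a / 2)"
      by (intro mult_left_mono) auto
    then show ?thesis using mult[OF assms(1)] by (simp add: add_increasing2)
  next
    case False
    then have "a powr (p - 1) * b \<le> (2 * b) powr (p - 1) * b"
      using assms by (intro mult_right_mono powr_mono2) auto
    also have "\<dots> = 2 powr (p - 1) * b powr p"
      using assms mult[OF assms(2)] by (simp add: powr_mult)
    finally show ?thesis by (simp add: add_increasing)
  qed
qed

lemma tendsto_powr_inverse_0: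
  fixes a :: "nat \<Rightarrow> real"
  assumes "(\<lambda>j. a j powr (1 / r)) \<longlonglongrightarrow> 0" "0 < r" "\<And>j. 0 \<le> a j"
  shows "a \<longlonglongrightarrow> 0"
proof -
  have "(\<lambda>j. (a j powr (1 / r)) powr r) \<longlonglongrightarrow> 0 powr r"
    using assms by (intro tendsto_powr2) auto
  then show ?thesis using assms by (simp add: powr_powr)
qed

lemma Lp_space_diff:
  assumes "u \<in> Lp_space r N" "w \<in> Lp_space r N" "0 < r"
  shows "integrable N (\<lambda>x. \<bar>u x - w x\<bar> powr r)"
proof (rule Bochner_Integration.integrable_bound)
  have [measurable]: "u \<in> borel_measurable N" "w \<in> borel_measurable N"
    using assms by (auto simp: Lp_space_def)
  show "(\<lambda>x. \<bar>u x - w x\<bar> powr r) \<in> borel_measurable N" by measurable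
  show "integrable N (\<lambda>x. 2 powr r * (\<bar>u x\<bar> powr r + \<bar>w x\<bar> powr r))"
    using assms by (auto simp: Lp_space_def)
  show "AE x in N. norm (\<bar>u x - w x\<bar> powr r) \<le> norm (2 powr r * (\<bar>u x\<bar> powr r + \<bar>w x\<bar> powr r))"
  proof (rule AE_I2)
    fix x
    have "\<bar>u x - w x\<bar> powr r \<le> (\<bar>u x\<bar> + \<bar>w x\<bar>) powr r"
      using assms(3) by (intro powr_mono2) auto
    also have "\<dots> \<le> 2 powr r * (\<bar>u x\<bar> powr r + \<bar>w x\<bar> powr r)"
      using assms(3) by (intro powr_add_le) auto
    finally show "norm (\<bar>u x - w x\<bar> powr r) \<le> norm (2 powr r * (\<bar>u x\<bar> powr r + \<bar>w x\<bar> powr r))"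
      by simp
  qed
qed

lemma integrable_bounded_mult:
  fixes k w G :: "_ \<Rightarrow> real"
  assumes "integrable N k" "w \<in> borel_measurable N"
    and "continuous_on UNIV G" "\<And>t. \<bar>G t\<bar> \<le> B"
  shows "integrable N (\<lambda>x. G (w x) * k x)"
proof (rule Bochner_Integration.integrable_bound)
  have [measurable]: "G \<in> borel_measurable borel"
    using assms(3) by (rule borel_measurable_continuous_onI)
  have [measurable]: "k \<in> borel_measurable N" "w \<in> borel_measurable N"
    using assms(1,2) by auto
  show "integrable N (\<lambda>x. B * k x)" using assms(1) by simp
  show "(\<lambda>x. G (w x) * k x) \<in> borel_measurable N" by measurable
  show "AE x in N. norm (G (w x) * k x) \<le> norm (B * k x)"
    by (rule AE_I2) (simp add: abs_mult mult_right_mono order_trans[OF assms(4) abs_ge_self])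
qed

text \<open>Dominated convergence with majorant \<open>B * \<bar>k x\<bar>\<close>. The alternative
  \<open>k x = 0\<close> covers integrals against Lebesgue measure of the energy density: the
  approximants converge almost everywhere for \<open>v dx\<close> only, and elsewhere the density
  vanishes.\<close>

lemma tendsto_integral_bounded_mult:
  fixes k u G :: "_ \<Rightarrow> real"
  assumes k: "integrable N k" and V: "\<And>j::nat. V j \<in> borel_measurable N" and u: "u \<in> borel_measurable N"
    and lim: "AE x in N. (\<lambda>j. V j x) \<longlonglongrightarrow> u x \<or> k x = 0"
    and G: "continuous_on UNIV G" "\<And>t. \<bar>G t\<bar> \<le> B"
  shows "(\<lambda>j. \<integral>x. G (V j x) * k x \<partial>N) \<longlonglongrightarrow> (\<integral>x. G (u x) * k x \<partial>N)"
proof (rule integral_dominated_convergence)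
  show "(\<lambda>x. G (u x) * k x) \<in> borel_measurable N"
    using integrable_bounded_mult[OF k u G] by (rule borel_measurable_integrable)
  show "(\<lambda>x. G (V j x) * k x) \<in> borel_measurable N" for j
    using integrable_bounded_mult[OF k V G] by (rule borel_measurable_integrable)
  show "integrable N (\<lambda>x. B * \<bar>k x\<bar>)" using k by simp
  show "AE x in N. norm (G (V j x) * k x) \<le> B * \<bar>k x\<bar>" for j
    by (rule AE_I2) (simp add: abs_mult mult_right_mono G(2))
  show "AE x in N. (\<lambda>j. G (V j x) * k x) \<longlonglongrightarrow> G (u x) * k x"
    using lim
  proof eventually_elim
    case (elim x)
    then show ?case
    proof
      assume "(\<lambda>j. V j x) \<longlonglongrightarrow> u x"
      moreover have "isCont G (u x)"
        using G(1) by (simp add: continuous_on_eq_continuous_at)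
      ultimately have "(\<lambda>j. G (V j x)) \<longlonglongrightarrow> G (u x)"
        by (rule isCont_tendsto_compose[rotated])
      then show ?thesis by (intro tendsto_mult tendsto_const)
    qed simp
  qed
qed

text \<open>Either \<open>a \<le> b powr (s - 1)\<close>, and the product is at most
  \<open>b powr s\<close>, or \<open>b\<close> is at most \<open>a powr (1 / (s - 1))\<close>, and
  the conjugate power of \<open>a\<close> dominates.\<close>

lemma crude_Young:
  fixes a b s :: real
  assumes "0 \<le> a" "0 \<le> b" "1 < s"
  shows "a * b \<le> a powr (s / (s - 1)) + b powr s"
proof (cases "a \<le> b powr (s - 1)")
  case True
  have "a * b \<le> b powr (s - 1) * b"
    using True assms by (intro mult_right_mono) auto
  also have "\<dots> = b powr s"
    using assms by (cases "b = 0") (simp_all add: powr_diff)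
  finally show ?thesis by (simp add: add_increasing)
next
  case False
  then have "(b powr (s - 1)) powr (1 / (s - 1)) \<le> a powr (1 / (s - 1))"
    using assms by (intro powr_mono2) auto
  then have "b \<le> a powr (1 / (s - 1))"
    using assms by (simp add: powr_powr)
  then have "a * b \<le> a powr 1 * a powr (1 / (s - 1))"
    using assms by (simp add: mult_left_mono)
  also have "\<dots> = a powr (s / (s - 1))"
  proof -
    have "1 + 1 / (s - 1) = s / (s - 1)" using assms(3) by (simp add: field_simps)
    then show ?thesis by (simp only: powr_add[symmetric])
  qed
  finally show ?thesis by (simp add: add_increasing2)
qed

text \<open>Constants are integrable for a finite measure, and
  \<open>\<bar>h x\<bar> \<le> \<bar>h x\<bar> powr r + 1\<close>.\<close>

lemma integrable_powr_le:
  fixes h :: "'a \<Rightarrow> real"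
  assumes "finite_measure N" "h \<in> borel_measurable N" "integrable N (\<lambda>x. \<bar>h x\<bar> powr r)" "1 \<le> r"
  shows "integrable N h"
proof (rule Bochner_Integration.integrable_bound)
  interpret finite_measure N by fact
  show "integrable N (\<lambda>x. \<bar>h x\<bar> powr r + 1)" using assms(3) by simp
  have "\<bar>h x\<bar> \<le> \<bar>h x\<bar> powr r + 1" for x
  proof (cases "1 \<le> \<bar>h x\<bar>")
    case True
    then have "\<bar>h x\<bar> powr 1 \<le> \<bar>h x\<bar> powr r" using assms(4) by (intro powr_mono) auto
    then show ?thesis by simp
  qed (simp add: add_increasing)
  then show "AE x in N. norm (h x) \<le> norm (\<bar>h x\<bar> powr r + 1)" by simp
qed (rule assms)

section \<open>Degenerate Sobolev spaces\<close>

text \<open>The conditions on the domain, the matrix and the weight. The Sobolev inequality is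
  passed to the lemmas as a premise, because its constant enters their bounds.\<close>

locale degenerate_domain =
  fixes \<Omega> :: "(real ^ 'n) set" and Q :: "real ^ 'n \<Rightarrow> real ^ 'n ^ 'n"
    and v :: "real ^ 'n \<Rightarrow> real" and p :: real
  assumes p: "1 < p" and open_domain: "open \<Omega>"
    and Q_measurable: "Q \<in> borel_measurable (lebesgue_on \<Omega>)"
    and Q_nonneg: "\<And>x. x \<in> \<Omega> \<Longrightarrow> nonneg_definite (Q x)"
    and v_nonneg: "\<And>x. x \<in> \<Omega> \<Longrightarrow> 0 \<le> v x"
    and v_loc: "v \<in> Lp_loc 1 \<Omega>"
    and omega_loc: "(\<lambda>x. op_norm (Q x)) \<in> Lp_loc (p / 2) \<Omega>"
    and weight: "\<exists>C>0. AE x in lebesgue_on \<Omega>. v x \<ge> C * op_norm (Q x) powr (p / 2)"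
begin

abbreviation "M \<equiv> lebesgue_on \<Omega>"
abbreviation "\<mu> \<equiv> weighted \<Omega> v"
abbreviation "qnorm g x \<equiv> norm (matrix_sqrt (Q x) *v g x)"

lemma v_measurable [measurable]: "v \<in> borel_measurable M"
  using v_loc by (simp add: Lp_loc_def)

lemma borel_measurable_weighted [simp]: "borel_measurable \<mu> = borel_measurable M"
  unfolding weighted_def by (intro measurable_cong_sets) simp_all

lemma AE_v_nonneg: "AE x in M. 0 \<le> v x"
  by (rule AE_I2) (simp add: v_nonneg)

lemma AE_weighted: "(AE x in \<mu>. P x) \<longleftrightarrow> (AE x in M. 0 < v x \<longrightarrow> P x)"
  unfolding weighted_def by (subst AE_density) auto

lemma integrable_weighted:
  fixes h :: "real ^ 'n \<Rightarrow> real"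
  assumes "h \<in> borel_measurable M"
  shows "integrable \<mu> h \<longleftrightarrow> integrable M (\<lambda>x. v x * h x)"
  unfolding weighted_def using assms v_measurable AE_v_nonneg by (subst integrable_density) auto

text \<open>This is the role of the weight condition: statements that hold almost everywhere for \<open>v dx\<close>
  can be used under integrals against \<open>|\<surd>Q g|\<^sup>p dx\<close>.\<close>

lemma AE_sqrt_eq_0: "AE x in M. v x = 0 \<longrightarrow> (\<forall>\<xi>. matrix_sqrt (Q x) *v \<xi> = 0)"
proof -
  obtain C where C: "C > 0" and ae: "AE x in M. v x \<ge> C * op_norm (Q x) powr (p / 2)"
    using weight by blast
  have "AE x in M. x \<in> \<Omega>" by (rule AE_I2) simp
  with ae show ?thesis
  proof eventually_elim
    case (elim x)
    show ?case
    proof (intro impI allI)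
      fix \<xi> assume "v x = 0"
      with elim(1) C have "op_norm (Q x) powr (p / 2) \<le> 0"
        by (simp add: mult_le_0_iff)
      then have "op_norm (Q x) = 0"
        by (metis powr_ge_zero order_antisym powr_eq_0_iff)
      then show "matrix_sqrt (Q x) *v \<xi> = 0"
        using norm_matrix_sqrt_le[OF Q_nonneg[OF elim(2)], of \<xi>] by simp
    qed
  qed
qed

text \<open>Up to a Lebesgue null set, \<open>P\<close> holds where \<open>v > 0\<close>, and the
  square root of \<open>Q\<close> vanishes where \<open>v = 0\<close>.\<close>

lemma AE_weighted_imp:
  assumes "AE x in \<mu>. P x"
  shows "AE x in M. P x \<or> (\<forall>\<xi>. matrix_sqrt (Q x) *v \<xi> = 0)"
  using assms[unfolded AE_weighted] AE_sqrt_eq_0 AE_v_nonneg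
  by eventually_elim auto

lemma measurable_Q_form:
  assumes [measurable]: "g \<in> borel_measurable M" "h \<in> borel_measurable M"
  shows "(\<lambda>x. h x \<bullet> (Q x *v g x)) \<in> borel_measurable M"
proof -
  note [measurable] = borel_measurable_vec_component[OF Q_measurable]
    borel_measurable_vec_component[OF assms(2)]
  have "(\<lambda>x. h x \<bullet> (Q x *v g x)) = (\<lambda>x. \<Sum>i\<in>UNIV. h x $ i * (Q x $ i \<bullet> g x))"
    by (simp add: inner_vec_def[of "h _"] matrix_vector_mul_component)
  then show ?thesis by simp
qed

text \<open>Measurability is read off from the quadratic form of \<open>Q\<close>, which bypasses
  the description operator in \<open>matrix_sqrt\<close>.\<close>

lemma measurable_qnorm [measurable]:
  assumes "g \<in> borel_measurable M"
  shows "qnorm g \<in> borel_measurable M"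
proof -
  have "(\<lambda>x. sqrt (g x \<bullet> (Q x *v g x))) \<in> borel_measurable M"
    using measurable_Q_form[OF assms assms] by measurable
  then show ?thesis
    by (rule measurable_cong[THEN iffD1, rotated]) (simp add: norm_matrix_sqrt Q_nonneg)
qed

section \<open>Lipschitz functions in the weighted spaces\<close>

lemma Lip0_measurable: "\<phi> \<in> Lip0 \<Omega> \<Longrightarrow> \<phi> \<in> borel_measurable M"
  using Lip0_continuous[OF _ open_domain] borel_measurable_continuous_onI
    borel_measurable_lebesgue_on by blast

lemma Lip0_Lp_space:
  assumes \<phi>: "\<phi> \<in> Lip0 \<Omega>" and r: "0 < r"
  shows "\<phi> \<in> Lp_space r \<mu>"
proof -
  define K where "K = closure {x. \<phi> x \<noteq> 0}"
  have K: "compact K" "K \<subseteq> \<Omega>" using \<phi> by (auto simp: Lip0_def K_def)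
  have [measurable]: "\<phi> \<in> borel_measurable M" using \<phi> by (rule Lip0_measurable)
  have "compact (\<phi> ` K)"
    using K Lip0_continuous[OF \<phi> open_domain]
    by (intro compact_continuous_image) (auto intro: continuous_on_subset)
  then obtain B where B: "\<And>x. x \<in> K \<Longrightarrow> \<bar>\<phi> x\<bar> \<le> B"
    using compact_imp_bounded[of "\<phi> ` K"] by (auto simp: bounded_iff)
  have out: "\<phi> x = 0" if "x \<notin> K" for x
    using that closure_subset[of "{x. \<phi> x \<noteq> 0}"] by (auto simp: K_def)
  have "integrable M (\<lambda>x. B powr r * (indicat_real K x * \<bar>v x\<bar> powr 1))"
    using Lp_loc_integrable[OF v_loc open_domain K] by simp
  then have "integrable M (\<lambda>x. v x * \<bar>\<phi> x\<bar> powr r)"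
  proof (rule Bochner_Integration.integrable_bound)
    show "AE x in M. norm (v x * \<bar>\<phi> x\<bar> powr r) \<le> norm (B powr r * (indicat_real K x * \<bar>v x\<bar> powr 1))"
    proof (rule AE_I2)
      fix x
      show "norm (v x * \<bar>\<phi> x\<bar> powr r) \<le> norm (B powr r * (indicat_real K x * \<bar>v x\<bar> powr 1))"
      proof (cases "x \<in> K")
        case True
        then have "\<bar>\<phi> x\<bar> powr r \<le> B powr r" using B r by (intro powr_mono2) auto
        then show ?thesis
          using True mult_left_mono[of "\<bar>\<phi> x\<bar> powr r" "B powr r" "\<bar>v x\<bar>"]
          by (simp add: abs_mult mult.commute)
      qed (simp add: out)
    qed
  qed measurable
  then show ?thesis by (simp add: Lp_space_def integrable_weighted)
qed

text \<open>On the support the integrand is at most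
  \<open>L powr p * op_norm (Q x) powr (p / 2)\<close>, which is integrable over compact sets by
  \<open>omega_loc\<close>; off the support the gradient is 0.\<close>

lemma Lip0_grad:
  assumes \<phi>: "\<phi> \<in> Lip0 \<Omega>"
  shows "grad \<phi> \<in> QLp_space p \<Omega> Q"
proof -
  define K where "K = closure {x. \<phi> x \<noteq> 0}"
  have K: "compact K" "K \<subseteq> \<Omega>" using \<phi> by (auto simp: Lip0_def K_def)
  obtain L where L: "L-lipschitz_on \<Omega> \<phi>" using \<phi> by (auto simp: Lip0_def)
  have meas[measurable]: "grad \<phi> \<in> borel_measurable M"
    using borel_measurable_grad[OF Lip0_continuous[OF \<phi> open_domain]]
    by (rule borel_measurable_lebesgue_on)
  have "integrable M (\<lambda>x. L powr p * (indicat_real K x * \<bar>op_norm (Q x)\<bar> powr (p / 2)))"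
    using Lp_loc_integrable[OF omega_loc open_domain K] by simp
  then have "integrable M (\<lambda>x. qnorm (grad \<phi>) x powr p)"
  proof (rule Bochner_Integration.integrable_bound)
    show "AE x in M. norm (qnorm (grad \<phi>) x powr p)
        \<le> norm (L powr p * (indicat_real K x * \<bar>op_norm (Q x)\<bar> powr (p / 2)))"
    proof (rule AE_I2)
      fix x assume "x \<in> space M"
      then have x: "x \<in> \<Omega>" by simp
      show "norm (qnorm (grad \<phi>) x powr p)
        \<le> norm (L powr p * (indicat_real K x * \<bar>op_norm (Q x)\<bar> powr (p / 2)))"
      proof (cases "x \<in> K")
        case True
        have "qnorm (grad \<phi>) x \<le> sqrt (op_norm (Q x)) * norm (grad \<phi> x)"
          by (rule norm_matrix_sqrt_le[OF Q_nonneg[OF x]])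
        also have "\<dots> \<le> sqrt (op_norm (Q x)) * L"
          by (intro mult_left_mono norm_grad_le[OF L open_domain x]) (simp add: op_norm_nonneg)
        finally have "qnorm (grad \<phi>) x powr p \<le> (sqrt (op_norm (Q x)) * L) powr p"
          using p by (intro powr_mono2) auto
        also have "\<dots> = op_norm (Q x) powr (p / 2) * L powr p"
          using lipschitz_on_nonneg[OF L] op_norm_nonneg[of "Q x"]
          by (simp add: powr_mult powr_half_sqrt[symmetric] powr_powr)
        finally show ?thesis
          using True op_norm_nonneg[of "Q x"] by (simp add: mult.commute)
      qed (simp add: K_def grad_eq_0)
    qed
  qed measurable
  then show ?thesis using meas by (simp add: QLp_space_def)
qed

lemma qnorm_diff_le: "qnorm (\<lambda>x. g x - h x) x \<le> qnorm g x + qnorm h x"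
  by (simp add: matrix_vector_mult_diff_distrib norm_triangle_ineq4)

lemma qnorm_le_diff: "qnorm h x \<le> qnorm g x + qnorm (\<lambda>x. g x - h x) x"
  by (simp add: matrix_vector_mult_diff_distrib)
    (metis add.commute norm_minus_commute norm_triangle_sub)

lemma QLp_space_diff:
  assumes "g \<in> QLp_space p \<Omega> Q" "h \<in> QLp_space p \<Omega> Q"
  shows "integrable M (\<lambda>x. qnorm (\<lambda>x. g x - h x) x powr p)"
proof (rule Bochner_Integration.integrable_bound)
  have [measurable]: "g \<in> borel_measurable M" "h \<in> borel_measurable M"
    using assms by (auto simp: QLp_space_def)
  have "(\<lambda>x. g x - h x) \<in> borel_measurable M" by measurable
  note [measurable] = measurable_qnorm[OF this]
  show "(\<lambda>x. qnorm (\<lambda>x. g x - h x) x powr p) \<in> borel_measurable M" by measurable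
  show "integrable M (\<lambda>x. 2 powr p * (qnorm g x powr p + qnorm h x powr p))"
    using assms by (auto simp: QLp_space_def)
  show "AE x in M. norm (qnorm (\<lambda>x. g x - h x) x powr p)
      \<le> norm (2 powr p * (qnorm g x powr p + qnorm h x powr p))"
  proof (rule AE_I2)
    fix x
    have "qnorm (\<lambda>x. g x - h x) x powr p \<le> (qnorm g x + qnorm h x) powr p"
      using p qnorm_diff_le by (intro powr_mono2) auto
    also have "\<dots> \<le> 2 powr p * (qnorm g x powr p + qnorm h x powr p)"
      using p by (intro powr_add_le) auto
    finally show "norm (qnorm (\<lambda>x. g x - h x) x powr p)
      \<le> norm (2 powr p * (qnorm g x powr p + qnorm h x powr p))" by simp
  qed
qed

text \<open>Convergence in the weighted space yields a subsequence converging almost everywhere,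
  along which the gradients still converge. Norms are replaced by their \<open>p\<close>-th powers,
  that is, by plain integrals.\<close>

lemma QH0_approximation:
  assumes "(u, g) \<in> QH0 p \<Omega> Q v"
  obtains V where "\<And>j::nat. V j \<in> Lip0 \<Omega>" "AE x in \<mu>. (\<lambda>j. V j x) \<longlonglongrightarrow> u x"
    "(\<lambda>j. \<integral>x. qnorm (\<lambda>x. g x - grad (V j) x) x powr p \<partial>M) \<longlonglongrightarrow> 0"
proof -
  have p0: "0 < p" using p by simp
  obtain U where u: "u \<in> Lp_space p \<mu>" and U: "\<And>j::nat. U j \<in> Lip0 \<Omega>"
    and lim: "(\<lambda>j. Lp_norm p \<mu> (\<lambda>x. u x - U j x)) \<longlonglongrightarrow> 0"
      "(\<lambda>j. QLp_norm p \<Omega> Q (\<lambda>x. g x - grad (U j) x)) \<longlonglongrightarrow> 0"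
    using assms unfolding QH0_def by blast
  have "(\<lambda>j. \<integral>x. \<bar>u x - U j x\<bar> powr p \<partial>\<mu>) \<longlonglongrightarrow> 0"
    using lim(1) p0 unfolding Lp_norm_def by (rule tendsto_powr_inverse_0) simp
  then obtain r where r: "strict_mono r"
    and ae: "AE x in \<mu>. (\<lambda>j. \<bar>u x - U (r j) x\<bar> powr p) \<longlonglongrightarrow> 0"
    using tendsto_L1_AE_subseq[of \<mu> "\<lambda>j x. \<bar>u x - U j x\<bar> powr p"]
      Lp_space_diff[OF u Lip0_Lp_space[OF U p0] p0] by auto
  show ?thesis
  proof
    show "U (r j) \<in> Lip0 \<Omega>" for j by (rule U)
    show "AE x in \<mu>. (\<lambda>j. U (r j) x) \<longlonglongrightarrow> u x"
      using ae
    proof eventually_elim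
      case (elim x)
      have "(\<lambda>j. \<bar>u x - U (r j) x\<bar>) \<longlonglongrightarrow> 0"
        by (rule tendsto_powr_inverse_0[of _ "1 / p"]) (use elim p0 in simp_all)
      then have "(\<lambda>j. u x - U (r j) x) \<longlonglongrightarrow> 0"
        by (simp add: tendsto_rabs_zero_iff)
      from tendsto_diff[OF tendsto_const[of "u x"] this] show ?case by simp
    qed
    have "(\<lambda>j. \<integral>x. qnorm (\<lambda>x. g x - grad (U j) x) x powr p \<partial>M) \<longlonglongrightarrow> 0"
      using lim(2) p0 unfolding QLp_norm_def by (rule tendsto_powr_inverse_0) simp
    then show "(\<lambda>j. \<integral>x. qnorm (\<lambda>x. g x - grad (U (r j)) x) x powr p \<partial>M) \<longlonglongrightarrow> 0"
      using r by (rule LIMSEQ_subseq_LIMSEQ[unfolded o_def])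
  qed
qed

lemma QH0_measurable:
  assumes "(u, g) \<in> QH0 p \<Omega> Q v"
  shows "u \<in> borel_measurable M" "g \<in> borel_measurable M"
    "integrable M (\<lambda>x. qnorm g x powr p)" "g \<in> QLp_space p \<Omega> Q"
  using assms by (auto simp: QH0_def Lp_space_def QLp_space_def)

text \<open>Provides the premise \<open>lim\<close> of \<open>tendsto_integral_bounded_mult\<close>
  when \<open>k\<close> is the energy density of \<open>g\<close>.\<close>

lemma qnorm_eq_0_imp:
  assumes "AE x in \<mu>. P x"
  shows "AE x in M. P x \<or> qnorm g x powr p = 0"
  using AE_weighted_imp[OF assms] by eventually_elim auto

lemma grad_compose_Lip0:
  assumes "\<phi> \<in> Lip0 \<Omega>" "\<And>t. (F has_real_derivative F' t) (at t)" "\<And>t. 0 < F' t"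
  shows "grad (\<lambda>y. F (\<phi> y)) x = F' (\<phi> x) *\<^sub>R grad \<phi> x"
proof (rule grad_compose)
  show "isCont \<phi> x"
    using Lip0_continuous[OF assms(1) open_domain] by (simp add: continuous_on_eq_continuous_at)
  show "F' (\<phi> x) \<noteq> 0" using assms(3)[of "\<phi> x"] by simp
qed (rule assms)

text \<open>The Sobolev inequality is applied to \<open>H (V j x)\<close>, whose gradient is
  \<open>H' (V j x) *\<^sub>R grad (V j) x\<close>. Replacing \<open>grad (V j)\<close> by
  \<open>g\<close> costs the factor \<open>2 powr p\<close> and an error proportional to
  \<open>a j\<close>, which tends to 0; the bounds on \<open>H\<close> and \<open>H'\<close> justify
  the other limits.\<close>

lemma sobolev_QH0:
  fixes S q B B0 :: real
  assumes sob: "\<And>\<phi>. \<phi> \<in> Lip0 \<Omega> \<Longrightarrow> Lp_norm q \<mu> \<phi> \<le> S * QLp_norm p \<Omega> Q (grad \<phi>)"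
    and S: "0 < S" and q: "0 < q" and fin: "finite_measure \<mu>"
    and ug: "(u, g) \<in> QH0 p \<Omega> Q v"
    and H: "\<And>t. (H has_real_derivative H' t) (at t)" "continuous_on UNIV H'"
      "\<And>t. 0 < H' t" "\<And>t. H' t \<le> B" "H 0 = 0" "\<And>t. \<bar>H t\<bar> \<le> B0"
  shows "(\<integral>x. \<bar>H (u x)\<bar> powr q \<partial>\<mu>) powr (p / q)
    \<le> S powr p * 2 powr p * (\<integral>x. H' (u x) powr p * qnorm g x powr p \<partial>M)"
proof -
  interpret finite_measure \<mu> by (rule fin)
  note um = QH0_measurable[OF ug]
  obtain V where V: "\<And>j::nat. V j \<in> Lip0 \<Omega>" and ae: "AE x in \<mu>. (\<lambda>j. V j x) \<longlonglongrightarrow> u x"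
    and lim: "(\<lambda>j. \<integral>x. qnorm (\<lambda>x. g x - grad (V j) x) x powr p \<partial>M) \<longlonglongrightarrow> 0"
    using QH0_approximation[OF ug] by blast
  have Vm: "V j \<in> borel_measurable M" for j using V by (rule Lip0_measurable)
  define W where "W j x = H (V j x)" for j x
  have W: "W j \<in> Lip0 \<Omega>" for j
    unfolding W_def using V H(1) by (rule Lip0_compose[where B = B])
      (use H in \<open>auto simp: abs_of_pos\<close>)
  have gradW: "qnorm (grad (W j)) x = H' (V j x) * qnorm (grad (V j)) x" for j x
  proof -
    have "grad (W j) x = H' (V j x) *\<^sub>R grad (V j) x"
      unfolding W_def using V H(1,3) by (rule grad_compose_Lip0)
    then show ?thesis
      using H(3)[of "V j x"] by (simp add: matrix_vector_mult_scaleR)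
  qed
  define A where "A j = (\<integral>x. \<bar>W j x\<bar> powr q \<partial>\<mu>)" for j
  define a where "a j = (\<integral>x. qnorm (\<lambda>x. g x - grad (V j) x) x powr p \<partial>M)" for j
  define b where "b j = (\<integral>x. H' (V j x) powr p * qnorm g x powr p \<partial>M)" for j
  have contp: "continuous_on UNIV (\<lambda>t. H' t powr p)"
    using H(2,3) by (intro continuous_on_powr continuous_on_const) (auto simp: less_imp_neq[symmetric])
  have bndp: "\<bar>H' t powr p\<bar> \<le> B powr p" for t
    using H(3)[of t] H(4)[of t] p by (simp add: powr_mono2)
  have le: "A j powr (p / q) \<le> S powr p * (2 powr p * (b j + B powr p * a j))" for j
  proof -
    have int: "integrable M (\<lambda>x. H' (V j x) powr p * qnorm g x powr p)"
      using um(3) Vm contp bndp by (rule integrable_bounded_mult)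
    have inta: "integrable M (\<lambda>x. qnorm (\<lambda>x. g x - grad (V j) x) x powr p)"
      using um(4) Lip0_grad[OF V] by (rule QLp_space_diff)
    have "(\<integral>x. qnorm (grad (W j)) x powr p \<partial>M)
        \<le> (\<integral>x. 2 powr p * (H' (V j x) powr p * qnorm g x powr p
            + B powr p * qnorm (\<lambda>x. g x - grad (V j) x) x powr p) \<partial>M)"
    proof (rule integral_mono)
      show "integrable M (\<lambda>x. qnorm (grad (W j)) x powr p)"
        using Lip0_grad[OF W] by (simp add: QLp_space_def)
      show "integrable M (\<lambda>x. 2 powr p * (H' (V j x) powr p * qnorm g x powr p
            + B powr p * qnorm (\<lambda>x. g x - grad (V j) x) x powr p))"
        using int inta by simp
      fix x
      have "qnorm (grad (W j)) x powr p
          \<le> (H' (V j x) * qnorm g x + B * qnorm (\<lambda>x. g x - grad (V j) x) x) powr p"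
      proof (rule powr_mono2)
        have "H' (V j x) * qnorm (grad (V j)) x
            \<le> H' (V j x) * (qnorm g x + qnorm (\<lambda>x. g x - grad (V j) x) x)"
          using H(3)[of "V j x"] by (intro mult_left_mono qnorm_le_diff) simp
        also have "\<dots> \<le> H' (V j x) * qnorm g x + B * qnorm (\<lambda>x. g x - grad (V j) x) x"
          using H(4)[of "V j x"] by (simp add: distrib_left mult_right_mono)
        finally show "qnorm (grad (W j)) x
            \<le> H' (V j x) * qnorm g x + B * qnorm (\<lambda>x. g x - grad (V j) x) x"
          by (simp only: gradW)
      qed (use p in auto)
      also have "\<dots> \<le> 2 powr p * ((H' (V j x) * qnorm g x) powr p
          + (B * qnorm (\<lambda>x. g x - grad (V j) x) x) powr p)"
        using p H(3)[of "V j x"] H(4)[of "V j x"] by (intro powr_add_le) auto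
      also have "\<dots> = 2 powr p * (H' (V j x) powr p * qnorm g x powr p
            + B powr p * qnorm (\<lambda>x. g x - grad (V j) x) x powr p)"
        using H(3)[of "V j x"] H(4)[of "V j x"] by (simp add: powr_mult)
      finally show "qnorm (grad (W j)) x powr p
        \<le> 2 powr p * (H' (V j x) powr p * qnorm g x powr p
            + B powr p * qnorm (\<lambda>x. g x - grad (V j) x) x powr p)" .
    qed
    also have "\<dots> = 2 powr p * (b j + B powr p * a j)"
      using int inta by (simp add: a_def b_def)
    finally have le1: "(\<integral>x. qnorm (grad (W j)) x powr p \<partial>M) \<le> 2 powr p * (b j + B powr p * a j)" .
    have "A j powr (1 / q) \<le> S * (\<integral>x. qnorm (grad (W j)) x powr p \<partial>M) powr (1 / p)"
      using sob[OF W, of j] by (simp add: Lp_norm_def QLp_norm_def A_def)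
    then have "(A j powr (1 / q)) powr p
        \<le> (S * (\<integral>x. qnorm (grad (W j)) x powr p \<partial>M) powr (1 / p)) powr p"
      using p by (intro powr_mono2) auto
    also have "(A j powr (1 / q)) powr p = A j powr (p / q)"
      by (simp add: powr_powr)
    also have "(S * (\<integral>x. qnorm (grad (W j)) x powr p \<partial>M) powr (1 / p)) powr p
        = S powr p * (\<integral>x. qnorm (grad (W j)) x powr p \<partial>M)"
      using S p by (simp add: powr_mult powr_powr)
    also have "\<dots> \<le> S powr p * (2 powr p * (b j + B powr p * a j))"
      using le1 by (intro mult_left_mono) auto
    finally show ?thesis .
  qed
  have limA: "A \<longlonglongrightarrow> (\<integral>x. \<bar>H (u x)\<bar> powr q \<partial>\<mu>)"
  proof -
    have contH: "continuous_on UNIV H"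
      using H(1) by (intro continuous_at_imp_continuous_on ballI DERIV_isCont)
    have "continuous_on UNIV (\<lambda>t. \<bar>H t\<bar> powr q)"
      using contH q by (intro continuous_on_powr' continuous_intros) auto
    moreover have "\<bar>\<bar>H t\<bar> powr q\<bar> \<le> B0 powr q" for t
      using H(6)[of t] q by (simp add: powr_mono2)
    ultimately have "(\<lambda>j. \<integral>x. \<bar>H (V j x)\<bar> powr q * 1 \<partial>\<mu>) \<longlonglongrightarrow> (\<integral>x. \<bar>H (u x)\<bar> powr q * 1 \<partial>\<mu>)"
      using ae Vm um(1) by (intro tendsto_integral_bounded_mult[where B = "B0 powr q"]) auto
    then show ?thesis by (simp add: A_def[abs_def] W_def)
  qed
  have limb: "b \<longlonglongrightarrow> (\<integral>x. H' (u x) powr p * qnorm g x powr p \<partial>M)"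
    unfolding b_def[abs_def]
    using um(3) Vm um(1) qnorm_eq_0_imp[OF ae] contp bndp by (rule tendsto_integral_bounded_mult)
  have "(\<lambda>j. A j powr (p / q)) \<longlonglongrightarrow> (\<integral>x. \<bar>H (u x)\<bar> powr q \<partial>\<mu>) powr (p / q)"
  proof (rule tendsto_powr'[OF limA tendsto_const])
    have "0 \<le> A j" for j by (simp add: A_def)
    \<comment> \<open>The limit of \<open>A\<close> may be 0; the power is still continuous there,
      as its exponent is positive and \<open>A j\<close> is non-negative.\<close>
    then show "(\<integral>x. \<bar>H (u x)\<bar> powr q \<partial>\<mu>) \<noteq> 0 \<or> 0 < p / q \<and> (\<forall>\<^sub>F j in sequentially. 0 \<le> A j)"
      using p q by simp
  qed
  moreover have "(\<lambda>j. S powr p * (2 powr p * (b j + B powr p * a j)))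
      \<longlonglongrightarrow> S powr p * (2 powr p * ((\<integral>x. H' (u x) powr p * qnorm g x powr p \<partial>M) + B powr p * 0))"
    using limb lim unfolding a_def by (intro tendsto_intros)
  ultimately show ?thesis
    using le by (intro LIMSEQ_le[of "\<lambda>j. A j powr (p / q)"]) (auto simp: mult.assoc)
qed

section \<open>The flux and the energy of a weak solution\<close>

lemma qnorm_form_le:
  assumes "x \<in> \<Omega>"
  shows "\<bar>h x \<bullet> (Q x *v g x)\<bar> \<le> qnorm h x * qnorm g x"
  using Cauchy_Schwarz_ineq2[of "matrix_sqrt (Q x) *v h x" "matrix_sqrt (Q x) *v g x"]
  by (simp add: inner_matrix_sqrt Q_nonneg assms)

lemma qnorm_flux_le:
  assumes "x \<in> \<Omega>"
  shows "\<bar>qnorm g x powr (p - 2) * (h x \<bullet> (Q x *v g x))\<bar> \<le> qnorm g x powr (p - 1) * qnorm h x"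
proof -
  have "\<bar>qnorm g x powr (p - 2) * (h x \<bullet> (Q x *v g x))\<bar>
      \<le> qnorm g x powr (p - 2) * (qnorm h x * qnorm g x)"
    using qnorm_form_le[OF assms, of h g] by (simp add: abs_mult mult_left_mono)
  also have "\<dots> = (qnorm g x powr (p - 2) * qnorm g x powr 1) * qnorm h x"
    by simp
  \<comment> \<open>Since \<open>0 powr a = 0\<close> for every \<open>a\<close>, exponents add also
    where the norm vanishes, even for \<open>p < 2\<close>.\<close>
  also have "qnorm g x powr (p - 2) * qnorm g x powr 1 = qnorm g x powr (p - 1)"
    by (simp only: powr_add[symmetric]) simp
  finally show ?thesis .
qed

lemma qnorm_energy:
  assumes "x \<in> \<Omega>"
  shows "qnorm g x powr (p - 2) * (g x \<bullet> (Q x *v g x)) = qnorm g x powr p"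
proof -
  have "g x \<bullet> (Q x *v g x) = qnorm g x * qnorm g x"
    using inner_matrix_sqrt[OF Q_nonneg[OF assms], of "g x" "g x"]
    by (simp add: power2_norm_eq_inner[symmetric] power2_eq_square)
  then have "qnorm g x powr (p - 2) * (g x \<bullet> (Q x *v g x))
      = qnorm g x powr (p - 2) * qnorm g x powr 1 * qnorm g x powr 1"
    by simp
  also have "\<dots> = qnorm g x powr p"
    by (simp only: powr_add[symmetric]) simp
  finally show ?thesis .
qed

text \<open>The equation is tested with the Lipschitz functions \<open>H (V j x)\<close>. Exchanging
  \<open>grad (V j)\<close> for \<open>g\<close> in the flux term costs at most half of the energy
  plus a multiple of \<open>a j\<close>, by \<open>powr_absorb\<close>. Absorbing the half produces
  the factor 2, and the remaining error disappears in the limit.\<close>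

lemma energy_estimate:
  fixes B B0 :: real
  assumes ug: "(u, g) \<in> QH0 p \<Omega> Q v" and f: "integrable \<mu> f"
    and weak: "\<And>\<phi>. \<phi> \<in> Lip0 \<Omega> \<Longrightarrow>
      (\<integral>x. qnorm g x powr (p - 2) * (grad \<phi> x \<bullet> (Q x *v g x)) \<partial>M) = (\<integral>x. f x * \<phi> x \<partial>\<mu>)"
    and H: "\<And>t. (H has_real_derivative H' t) (at t)" "continuous_on UNIV H'"
      "\<And>t. 0 < H' t" "\<And>t. H' t \<le> B" "H 0 = 0" "\<And>t. \<bar>H t\<bar> \<le> B0"
  shows "(\<integral>x. H' (u x) * qnorm g x powr p \<partial>M) \<le> 2 * (\<integral>x. f x * H (u x) \<partial>\<mu>)"
proof -
  note um = QH0_measurable[OF ug]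
  obtain V where V: "\<And>j::nat. V j \<in> Lip0 \<Omega>" and ae: "AE x in \<mu>. (\<lambda>j. V j x) \<longlonglongrightarrow> u x"
    and lim: "(\<lambda>j. \<integral>x. qnorm (\<lambda>x. g x - grad (V j) x) x powr p \<partial>M) \<longlonglongrightarrow> 0"
    using QH0_approximation[OF ug] by blast
  have Vm: "V j \<in> borel_measurable M" for j using V by (rule Lip0_measurable)
  have bnd: "\<bar>H' t\<bar> \<le> B" for t
    using H(3)[of t] H(4)[of t] by simp
  have W: "(\<lambda>x. H (V j x)) \<in> Lip0 \<Omega>" for j
    using V H(1) bnd H(5) by (rule Lip0_compose)
  define a where "a j = (\<integral>x. qnorm (\<lambda>x. g x - grad (V j) x) x powr p \<partial>M)" for j
  define b where "b j = (\<integral>x. H' (V j x) * qnorm g x powr p \<partial>M)" for j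
  define c where "c j = (\<integral>x. f x * H (V j x) \<partial>\<mu>)" for j
  have le: "b j \<le> 2 * c j + 2 * (B * 2 powr (p - 1)) * a j" for j
  proof -
    define F where "F x = qnorm g x powr (p - 2) * (grad (V j) x \<bullet> (Q x *v g x))" for x
    have gV: "grad (V j) \<in> QLp_space p \<Omega> Q" by (rule Lip0_grad[OF V])
    then have gVm: "grad (V j) \<in> borel_measurable M"
      and gVi: "integrable M (\<lambda>x. qnorm (grad (V j)) x powr p)"
      by (auto simp: QLp_space_def)
    have inta: "integrable M (\<lambda>x. qnorm (\<lambda>x. g x - grad (V j) x) x powr p)"
      using um(4) gV by (rule QLp_space_diff)
    have intF: "integrable M F"
    proof (rule Bochner_Integration.integrable_bound)
      show "integrable M (\<lambda>x. qnorm g x powr p / 2 + 2 powr (p - 1) * qnorm (grad (V j)) x powr p)"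
        using um(3) gVi by simp
      have [measurable]: "qnorm g \<in> borel_measurable M" by (rule measurable_qnorm[OF um(2)])
      have [measurable]: "(\<lambda>x. grad (V j) x \<bullet> (Q x *v g x)) \<in> borel_measurable M"
        using um(2) gVm by (rule measurable_Q_form)
      show "F \<in> borel_measurable M" unfolding F_def by measurable
      show "AE x in M. norm (F x)
          \<le> norm (qnorm g x powr p / 2 + 2 powr (p - 1) * qnorm (grad (V j)) x powr p)"
      proof (rule AE_I2)
        fix x assume "x \<in> space M"
        then have x: "x \<in> \<Omega>" by simp
        have "\<bar>F x\<bar> \<le> qnorm g x powr (p - 1) * qnorm (grad (V j)) x"
          unfolding F_def by (rule qnorm_flux_le[OF x])
        also have "\<dots> \<le> qnorm g x powr p / 2 + 2 powr (p - 1) * qnorm (grad (V j)) x powr p"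
          using p by (intro powr_absorb) auto
        finally show "norm (F x)
          \<le> norm (qnorm g x powr p / 2 + 2 powr (p - 1) * qnorm (grad (V j)) x powr p)"
          by simp
      qed
    qed
    have int: "integrable M (\<lambda>x. H' (V j x) * qnorm g x powr p)"
      using um(3) Vm H(2) bnd by (rule integrable_bounded_mult)
    have intHF: "integrable M (\<lambda>x. H' (V j x) * F x)"
      using intF Vm H(2) bnd by (rule integrable_bounded_mult)
    have "b j \<le> (\<integral>x. 2 * (H' (V j x) * F x)
        + 2 * (B * 2 powr (p - 1)) * qnorm (\<lambda>x. g x - grad (V j) x) x powr p \<partial>M)"
      unfolding b_def
    proof (rule integral_mono)
      show "integrable M (\<lambda>x. H' (V j x) * qnorm g x powr p)" by (rule int)
      show "integrable M (\<lambda>x. 2 * (H' (V j x) * F x)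
        + 2 * (B * 2 powr (p - 1)) * qnorm (\<lambda>x. g x - grad (V j) x) x powr p)"
        using intHF inta by simp
      fix x assume "x \<in> space M"
      then have x: "x \<in> \<Omega>" by simp
      define N d where "N = qnorm g x" and "d = qnorm (\<lambda>x. g x - grad (V j) x) x"
      \<comment> \<open>Writing \<open>grad (V j) x\<close> as \<open>g x\<close> minus the
        difference isolates the full energy density.\<close>
      have "F x = N powr p - qnorm g x powr (p - 2) * ((g x - grad (V j) x) \<bullet> (Q x *v g x))"
        using qnorm_energy[OF x, of g] by (simp add: F_def N_def inner_diff_left right_diff_distrib)
      moreover have "\<bar>qnorm g x powr (p - 2) * ((g x - grad (V j) x) \<bullet> (Q x *v g x))\<bar>
          \<le> N powr (p - 1) * d"
        using qnorm_flux_le[OF x, of g "\<lambda>x. g x - grad (V j) x"] by (simp add: N_def d_def)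
      moreover have "N powr (p - 1) * d \<le> N powr p / 2 + 2 powr (p - 1) * d powr p"
        using p by (intro powr_absorb) (auto simp: N_def d_def)
      ultimately have "N powr p \<le> 2 * F x + 2 * (2 powr (p - 1) * d powr p)"
        by linarith
      then have "H' (V j x) * N powr p \<le> H' (V j x) * (2 * F x + 2 * (2 powr (p - 1) * d powr p))"
        using H(3)[of "V j x"] by (intro mult_left_mono) auto
      also have "\<dots> = 2 * (H' (V j x) * F x) + H' (V j x) * (2 * (2 powr (p - 1) * d powr p))"
        by (simp add: algebra_simps)
      also have "H' (V j x) * (2 * (2 powr (p - 1) * d powr p)) \<le> B * (2 * (2 powr (p - 1) * d powr p))"
        using H(4) by (intro mult_right_mono) auto
      finally show "H' (V j x) * qnorm g x powr p \<le> 2 * (H' (V j x) * F x)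
        + 2 * (B * 2 powr (p - 1)) * qnorm (\<lambda>x. g x - grad (V j) x) x powr p"
        by (simp add: N_def d_def mult_ac)
    qed
    also have "\<dots> = 2 * (\<integral>x. H' (V j x) * F x \<partial>M) + 2 * (B * 2 powr (p - 1)) * a j"
      using intHF inta by (simp add: a_def)
    also have "(\<integral>x. H' (V j x) * F x \<partial>M) = c j"
    proof -
      have "grad (\<lambda>x. H (V j x)) x = H' (V j x) *\<^sub>R grad (V j) x" for x
        using V H(1,3) by (rule grad_compose_Lip0)
      then show ?thesis
        using weak[OF W, of j] by (simp add: F_def c_def mult_ac)
    qed
    finally show ?thesis .
  qed
  have "b \<longlonglongrightarrow> (\<integral>x. H' (u x) * qnorm g x powr p \<partial>M)"
    unfolding b_def[abs_def]
    using um(3) Vm um(1) qnorm_eq_0_imp[OF ae] H(2) bnd by (rule tendsto_integral_bounded_mult)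
  moreover have "c \<longlonglongrightarrow> (\<integral>x. f x * H (u x) \<partial>\<mu>)"
  proof -
    have "continuous_on UNIV H"
      using H(1) by (intro continuous_at_imp_continuous_on ballI DERIV_isCont)
    then have "(\<lambda>j. \<integral>x. H (V j x) * f x \<partial>\<mu>) \<longlonglongrightarrow> (\<integral>x. H (u x) * f x \<partial>\<mu>)"
      using f ae Vm um(1) H(6) by (intro tendsto_integral_bounded_mult[where B = B0]) auto
    then show ?thesis by (simp add: c_def[abs_def] mult.commute)
  qed
  then have "(\<lambda>j. 2 * c j + 2 * (B * 2 powr (p - 1)) * a j)
      \<longlonglongrightarrow> 2 * (\<integral>x. f x * H (u x) \<partial>\<mu>) + 2 * (B * 2 powr (p - 1)) * 0"
    using lim unfolding a_def by (intro tendsto_intros)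
  ultimately show ?thesis
    using le by (intro LIMSEQ_le[of b]) auto
qed

section \<open>Exponential integrability\<close>

text \<open>The bound involves neither \<open>T\<close> nor \<open>R\<close>, so that the truncation
  can be removed afterwards. In terms of the constants \<open>\<kappa>\<close> and \<open>c\<close>
  of the proof, the smallness condition reads \<open>\<kappa> * (F + 2 * c) < 1\<close>.\<close>

lemma truncated_exponential_estimate:
  fixes S \<sigma> \<beta> R :: real and f :: "real ^ 'n \<Rightarrow> real"
  defines "F \<equiv> \<integral>x. \<bar>f x\<bar> powr (\<sigma> / (\<sigma> - 1)) \<partial>\<mu>"
  assumes sigma: "1 < \<sigma>" and fin: "finite_measure \<mu>"
    and S: "0 < S" and sob: "\<And>\<phi>. \<phi> \<in> Lip0 \<Omega> \<Longrightarrow> Lp_norm (p * \<sigma>) \<mu> \<phi> \<le> S * QLp_norm p \<Omega> Q (grad \<phi>)"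
    and f: "f \<in> Lp_space (\<sigma> / (\<sigma> - 1)) \<mu>"
    and sol: "weak_solution p \<sigma> \<Omega> Q v f u g"
    and \<beta>: "0 < \<beta>"
      "S powr p * 2 powr p * (\<beta> powr (p - 1) / p) * 2 * (F + 2 * (2 * 2 powr p) powr \<sigma>) < 1"
    and T: "\<And>t. (T has_real_derivative T' t) (at t)" "continuous_on UNIV T'"
      "\<And>t. 0 < T' t" "\<And>t. T' t \<le> 1" "T 0 = 0" "\<And>t. \<bar>T t\<bar> \<le> R"
  shows "(\<integral>\<^sup>+x. ennreal (exp (p * \<beta> * T (u x))) \<partial>\<mu>) \<le> ennreal (3 * 2 powr p) * emeasure \<mu> \<Omega>"
proof -
  interpret finite_measure \<mu> by (rule fin)
  have ug: "(u, g) \<in> QH0 p \<Omega> Q v" using sol by (simp add: weak_solution_def)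
  have [measurable]: "u \<in> borel_measurable M" by (rule QH0_measurable[OF ug])
  have fm: "f \<in> borel_measurable M" and fi: "integrable \<mu> (\<lambda>x. \<bar>f x\<bar> powr (\<sigma> / (\<sigma> - 1)))"
    using f by (auto simp: Lp_space_def)
  note [measurable] = fm
  have s1: "1 \<le> \<sigma> / (\<sigma> - 1)" using sigma by simp
  have f1: "integrable \<mu> f"
    using fin _ fi s1 by (rule integrable_powr_le) (simp add: fm)

  \<comment> \<open>The test functions and their bounds\<close>
  define H where "H t = exp (\<beta> * T t) - 1" for t
  define P where "P t = exp (p * \<beta> * T t) - 1" for t
  have contT: "continuous_on UNIV T"
    using T(1) by (intro continuous_at_imp_continuous_on ballI DERIV_isCont)
  have expT: "exp (c * T t) \<le> exp (c * R)" "\<bar>exp (c * T t) - 1\<bar> \<le> exp (c * R) + 1" if "0 < c" for c t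
  proof -
    have "T t \<le> R" using T(6)[of t] by simp
    then show 1: "exp (c * T t) \<le> exp (c * R)" using that by simp
    have "0 < exp (c * T t)" by simp
    with 1 show "\<bar>exp (c * T t) - 1\<bar> \<le> exp (c * R) + 1" by linarith
  qed
  have der: "((\<lambda>t. exp (c * T t) - 1) has_real_derivative c * T' t * exp (c * T t)) (at t)" for c t
    by (auto intro!: derivative_eq_intros T(1))
  have cont: "continuous_on UNIV (\<lambda>t. c * T' t * exp (c * T t))" for c
    using contT T(2) by (intro continuous_intros)
  have bnd: "c * T' t * exp (c * T t) \<le> c * exp (c * R)" if "0 < c" for c t
    using that mult_mono[OF T(4)[of t] expT(1)[OF that, of t]] by (simp add: mult.assoc)
  have pos: "0 < c * T' t * exp (c * T t)" if "0 < c" for c t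
    using that T(3) by simp
  have pb: "0 < p * \<beta>" using \<beta>(1) p by simp
  define m where "m = measure \<mu> \<Omega>"
  have sp: "space \<mu> = \<Omega>" by (simp add: weighted_def)
  have intconst: "(\<integral>x. c \<partial>\<mu>) = c * m" for c
    by (simp add: m_def sp mult.commute)
  have intbnd: "integrable \<mu> (\<lambda>x. G (u x))"
    if "continuous_on UNIV G" "\<And>t. \<bar>G t\<bar> \<le> B" for G :: "real \<Rightarrow> real" and B
    using integrable_bounded_mult[of \<mu> "\<lambda>_. 1" u G B] that by simp
  have contH: "continuous_on UNIV H" and contP: "continuous_on UNIV P"
    unfolding H_def P_def using contT by (auto intro!: continuous_intros)
  have contHr: "continuous_on UNIV (\<lambda>t. \<bar>H t\<bar> powr r)" if "0 < r" for r
    using contH that by (intro continuous_on_powr' continuous_intros) auto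
  have bndHr: "\<bar>\<bar>H t\<bar> powr r\<bar> \<le> (exp (\<beta> * R) + 1) powr r" if "0 < r" for r t
    using expT(2)[OF \<beta>(1), of t] that by (simp add: H_def powr_mono2)
  have intH: "integrable \<mu> (\<lambda>x. \<bar>H (u x)\<bar> powr r)" if "0 < r" for r
    using contHr[OF that] bndHr[OF that] by (rule intbnd)
  have psig: "0 < p * \<sigma>" using p sigma by simp
  \<comment> \<open>The exponential is the \<open>p\<close>-th power of \<open>H t + 1\<close>, and
    \<open>\<bar>P t\<bar>\<close> is at most the larger of the exponential and 1.\<close>
  have key: "exp (p * \<beta> * T t) \<le> 2 powr p * (\<bar>H t\<bar> powr p + 1)" "\<bar>P t\<bar> \<le> 2 powr p * (\<bar>H t\<bar> powr p + 1)" for t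
  proof -
    have "exp (\<beta> * T t) powr p \<le> (\<bar>H t\<bar> + 1) powr p"
      using p by (intro powr_mono2) (auto simp: H_def)
    also have "\<dots> \<le> 2 powr p * (\<bar>H t\<bar> powr p + 1 powr p)"
      using p by (intro powr_add_le) auto
    finally show 1: "exp (p * \<beta> * T t) \<le> 2 powr p * (\<bar>H t\<bar> powr p + 1)"
      by (simp add: powr_def mult_ac)
    have "1 * 1 \<le> 2 powr p * (\<bar>H t\<bar> powr p + 1)"
      using p by (intro mult_mono) (auto simp: ge_one_powr_ge_zero)
    moreover have "0 < exp (p * \<beta> * T t)" by simp
    ultimately show "\<bar>P t\<bar> \<le> 2 powr p * (\<bar>H t\<bar> powr p + 1)"
      using 1 unfolding P_def by linarith
  qed

  \<comment> \<open>The Sobolev and energy estimates combined\<close>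
  define Y where "Y = (\<integral>x. \<bar>H (u x)\<bar> powr (p * \<sigma>) \<partial>\<mu>)"
  define X where "X = Y powr (1 / \<sigma>)"
  define \<kappa> where "\<kappa> = S powr p * 2 powr p * (\<beta> powr (p - 1) / p) * 2"
  have \<kappa>: "0 < \<kappa>" using S \<beta>(1) p by (simp add: \<kappa>_def)
  have X_le: "X \<le> \<kappa> * (\<integral>x. f x * P (u x) \<partial>\<mu>)"
  proof -
    have "X = Y powr (p / (p * \<sigma>))" using p by (simp add: X_def)
    also have "\<dots> \<le> S powr p * 2 powr p *
        (\<integral>x. (\<beta> * T' (u x) * exp (\<beta> * T (u x))) powr p * qnorm g x powr p \<partial>M)"
      unfolding Y_def
      by (rule sobolev_QH0[OF sob S psig fin ug, where B = "\<beta> * exp (\<beta> * R)" and B0 = "exp (\<beta> * R) + 1"])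
        (use der[of \<beta>] cont[of \<beta>] pos[OF \<beta>(1)] bnd[OF \<beta>(1)] expT(2)[OF \<beta>(1)] T(5)
          in \<open>simp_all add: H_def\<close>)
    also have "\<dots> \<le> S powr p * 2 powr p * ((\<beta> powr (p - 1) / p) *
        (\<integral>x. p * \<beta> * T' (u x) * exp (p * \<beta> * T (u x)) * qnorm g x powr p \<partial>M))"
    proof (intro mult_left_mono)
      \<comment> \<open>From \<open>0 < T' t \<le> 1\<close> and \<open>p > 1\<close> one has
        \<open>T' t powr p \<le> T' t\<close>, so the \<open>p\<close>-th power of the derivative of
        \<open>H\<close> is controlled by the derivative of \<open>P\<close>.\<close>
      have le: "(\<beta> * T' t * exp (\<beta> * T t)) powr p
          \<le> (\<beta> powr (p - 1) / p) * (p * \<beta> * T' t * exp (p * \<beta> * T t))" for t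
      proof -
        have "T' t powr p \<le> T' t powr 1"
          using T(3)[of t] T(4)[of t] p by (intro powr_mono') auto
        then have "T' t powr p \<le> T' t" using T(3)[of t] by simp
        moreover have "(\<beta> * T' t * exp (\<beta> * T t)) powr p = \<beta> powr p * exp (p * \<beta> * T t) * T' t powr p"
          using \<beta>(1) T(3)[of t] by (simp add: powr_mult powr_def[of "exp _"] mult_ac)
        ultimately have "(\<beta> * T' t * exp (\<beta> * T t)) powr p \<le> \<beta> powr p * exp (p * \<beta> * T t) * T' t"
          by (simp add: mult_left_mono)
        also have "\<beta> powr p = \<beta> powr (p - 1) * \<beta>"
          using \<beta>(1) by (simp add: powr_diff)
        finally show ?thesis using p by (simp add: mult_ac)
      qed
      let ?G = "\<lambda>t. p * \<beta> * T' t * exp (p * \<beta> * T t)"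
      have int: "integrable M (\<lambda>x. ?G (u x) * qnorm g x powr p)"
        using QH0_measurable(3)[OF ug] QH0_measurable(1)[OF ug] cont[of "p * \<beta>"]
      proof (rule integrable_bounded_mult)
        show "\<bar>?G t\<bar> \<le> p * \<beta> * exp (p * \<beta> * R)" for t
          using bnd[OF pb, of t] pos[OF pb, of t] by (simp only: abs_of_pos)
      qed
      have "(\<integral>x. (\<beta> * T' (u x) * exp (\<beta> * T (u x))) powr p * qnorm g x powr p \<partial>M)
          \<le> (\<integral>x. (\<beta> powr (p - 1) / p) * (?G (u x) * qnorm g x powr p) \<partial>M)"
      proof (rule integral_mono')
        show "integrable M (\<lambda>x. (\<beta> powr (p - 1) / p) * (?G (u x) * qnorm g x powr p))"
          using int by (rule integrable_mult_right)
        show "(\<beta> * T' (u x) * exp (\<beta> * T (u x))) powr p * qnorm g x powr p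
            \<le> (\<beta> powr (p - 1) / p) * (?G (u x) * qnorm g x powr p)" for x
          using mult_right_mono[OF le[of "u x"], of "qnorm g x powr p"] by (simp only: mult.assoc powr_ge_zero)
        show "0 \<le> (\<beta> powr (p - 1) / p) * (?G (u x) * qnorm g x powr p)" for x
          using p \<beta>(1) less_imp_le[OF T(3)[of "u x"]] by simp
      qed
      then show "(\<integral>x. (\<beta> * T' (u x) * exp (\<beta> * T (u x))) powr p * qnorm g x powr p \<partial>M)
          \<le> (\<beta> powr (p - 1) / p) * (\<integral>x. ?G (u x) * qnorm g x powr p \<partial>M)"
        by (simp only: integral_mult_right_zero)
    qed auto
    also have "\<dots> \<le> S powr p * 2 powr p * ((\<beta> powr (p - 1) / p) * (2 * (\<integral>x. f x * P (u x) \<partial>\<mu>)))"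
    proof (intro mult_left_mono)
      show "(\<integral>x. p * \<beta> * T' (u x) * exp (p * \<beta> * T (u x)) * qnorm g x powr p \<partial>M)
          \<le> 2 * (\<integral>x. f x * P (u x) \<partial>\<mu>)"
        by (rule energy_estimate[OF ug f1, where B = "p * \<beta> * exp (p * \<beta> * R)"
              and B0 = "exp (p * \<beta> * R) + 1"])
          (use der[of "p * \<beta>"] cont[of "p * \<beta>"] pos[OF pb] bnd[OF pb] expT(2)[OF pb] T(5) sol
            in \<open>simp_all add: P_def weak_solution_def\<close>)
    qed (use p in auto)
    finally show ?thesis by (simp add: \<kappa>_def mult_ac)
  qed
  \<comment> \<open>If \<open>m < Y\<close>, the integral of \<open>f P(u)\<close> is bounded by a multiple of \<open>X\<close> and is absorbed,
    because \<open>\<beta>\<close> is small.\<close>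
  have "Y \<le> m"
  proof (rule ccontr)
    assume "\<not> Y \<le> m"
    then have Ym: "m < Y" by simp
    moreover have "0 \<le> m" by (simp add: m_def)
    ultimately have Y: "0 < Y" by simp
    have X: "0 < X" using Y by (simp add: X_def)
    have Xs: "X powr \<sigma> = Y" using Y sigma by (simp add: X_def powr_powr)
    define c where "c = (2 * 2 powr p) powr \<sigma>"
    have c0: "0 \<le> c" by (simp add: c_def)
    \<comment> \<open>\<open>crude_Young\<close> is applied to \<open>\<bar>f x\<bar>\<close> and
      \<open>\<bar>P (u x)\<bar> / X\<close>. As \<open>X powr \<sigma> = Y\<close>, this
      normalisation makes the integral at most a fixed multiple of \<open>X\<close>.\<close>
    have le: "f x * P (u x) \<le> X * (\<bar>f x\<bar> powr (\<sigma> / (\<sigma> - 1)) + c / Y * (\<bar>H (u x)\<bar> powr (p * \<sigma>) + 1))"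
      for x
    proof -
      have "\<bar>P (u x)\<bar> powr \<sigma> \<le> (2 powr p * (\<bar>H (u x)\<bar> powr p + 1)) powr \<sigma>"
        using key(2)[of "u x"] sigma by (intro powr_mono2) auto
      also have "\<dots> = (2 powr p) powr \<sigma> * (\<bar>H (u x)\<bar> powr p + 1) powr \<sigma>"
        by (rule powr_mult)
      also have "(\<bar>H (u x)\<bar> powr p + 1) powr \<sigma> \<le> 2 powr \<sigma> * ((\<bar>H (u x)\<bar> powr p) powr \<sigma> + 1 powr \<sigma>)"
        using sigma by (intro powr_add_le) auto
      finally have P: "\<bar>P (u x)\<bar> powr \<sigma> \<le> c * (\<bar>H (u x)\<bar> powr (p * \<sigma>) + 1)"
        by (simp add: c_def powr_mult powr_powr mult_ac)
      have "f x * P (u x) \<le> \<bar>f x\<bar> * \<bar>P (u x)\<bar>"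
        by (metis abs_ge_self abs_mult)
      also have "\<dots> = X * (\<bar>f x\<bar> * (\<bar>P (u x)\<bar> / X))" using X by simp
      also have "\<dots> \<le> X * (\<bar>f x\<bar> powr (\<sigma> / (\<sigma> - 1)) + (\<bar>P (u x)\<bar> / X) powr \<sigma>)"
        using X sigma by (intro mult_left_mono crude_Young) auto
      also have "(\<bar>P (u x)\<bar> / X) powr \<sigma> = \<bar>P (u x)\<bar> powr \<sigma> / Y"
        using X Xs by (simp add: powr_divide)
      also have "\<bar>P (u x)\<bar> powr \<sigma> / Y \<le> c * (\<bar>H (u x)\<bar> powr (p * \<sigma>) + 1) / Y"
        using P Y by (intro divide_right_mono) auto
      finally show ?thesis using X by simp
    qed
    have "(\<integral>x. f x * P (u x) \<partial>\<mu>)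
        \<le> (\<integral>x. X * (\<bar>f x\<bar> powr (\<sigma> / (\<sigma> - 1)) + c / Y * (\<bar>H (u x)\<bar> powr (p * \<sigma>) + 1)) \<partial>\<mu>)"
    proof (rule integral_mono)
      have "integrable \<mu> (\<lambda>x. P (u x) * f x)"
        using f1 _ contP expT(2)[OF pb, folded P_def]
        by (rule integrable_bounded_mult) simp
      then show "integrable \<mu> (\<lambda>x. f x * P (u x))" by (simp add: mult.commute)
      show "integrable \<mu> (\<lambda>x. X * (\<bar>f x\<bar> powr (\<sigma> / (\<sigma> - 1)) + c / Y * (\<bar>H (u x)\<bar> powr (p * \<sigma>) + 1)))"
        using fi intH[OF psig] by simp
    qed (rule le)
    also have "\<dots> = X * (F + c / Y * (Y + m))"
      using fi intH[OF psig] intconst[of 1] by (simp add: F_def Y_def)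
    \<comment> \<open>The assumption \<open>m < Y\<close> bounds \<open>Y + m\<close> by
      \<open>2 * Y\<close>, which cancels the denominator.\<close>
    also have "\<dots> \<le> X * (F + 2 * c)"
    proof (intro mult_left_mono add_left_mono)
      have "c / Y * (Y + m) \<le> c / Y * (2 * Y)"
        using Ym c0 Y by (intro mult_left_mono) auto
      then show "c / Y * (Y + m) \<le> 2 * c" using Y by simp
    qed (use X in simp)
    finally have "\<kappa> * (\<integral>x. f x * P (u x) \<partial>\<mu>) \<le> \<kappa> * (X * (F + 2 * c))"
      using \<kappa> by simp
    with X_le have "X \<le> (\<kappa> * (F + 2 * c)) * X" by (simp add: mult_ac)
    moreover have "(\<kappa> * (F + 2 * c)) * X < 1 * X"
      using \<beta>(2) X by (intro mult_strict_right_mono) (auto simp: \<kappa>_def c_def)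
    ultimately show False by simp
  qed

  \<comment> \<open>From the bound on \<open>Y\<close> to the exponential integral\<close>
  have intE: "integrable \<mu> (\<lambda>x. exp (p * \<beta> * T (u x)))"
  proof (rule intbnd)
    show "continuous_on UNIV (\<lambda>t. exp (p * \<beta> * T t))"
      using contT by (intro continuous_intros)
    show "\<bar>exp (p * \<beta> * T t)\<bar> \<le> exp (p * \<beta> * R)" for t
      using expT(1)[OF pb] by simp
  qed
  \<comment> \<open>The summand 2 consists of the 1 in \<open>key\<close> and the 1 lost in passing
    from the power \<open>p\<close> to the power \<open>p * \<sigma>\<close>. Together with
    \<open>Y \<le> m\<close> it yields the constant 3.\<close>
  have "(\<integral>x. exp (p * \<beta> * T (u x)) \<partial>\<mu>) \<le> (\<integral>x. 2 powr p * (\<bar>H (u x)\<bar> powr (p * \<sigma>) + 2) \<partial>\<mu>)"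
  proof (rule integral_mono[OF intE])
    show "integrable \<mu> (\<lambda>x. 2 powr p * (\<bar>H (u x)\<bar> powr (p * \<sigma>) + 2))"
      using intH[OF psig] by simp
    fix x
    have "\<bar>H (u x)\<bar> powr p \<le> \<bar>H (u x)\<bar> powr (p * \<sigma>) + 1"
    proof (cases "1 \<le> \<bar>H (u x)\<bar>")
      case True
      have "p * 1 \<le> p * \<sigma>" using p sigma by (intro mult_left_mono) auto
      with True have "\<bar>H (u x)\<bar> powr p \<le> \<bar>H (u x)\<bar> powr (p * \<sigma>)"
        by (intro powr_mono) auto
      then show ?thesis by simp
    next
      case False
      then have "\<bar>H (u x)\<bar> powr p \<le> 1" using p by (intro powr_le1) auto
      then show ?thesis by (simp add: add_increasing)
    qed
    then have "2 powr p * (\<bar>H (u x)\<bar> powr p + 1) \<le> 2 powr p * (\<bar>H (u x)\<bar> powr (p * \<sigma>) + 2)"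
      by (intro mult_left_mono) auto
    with key(1)[of "u x"]
    show "exp (p * \<beta> * T (u x)) \<le> 2 powr p * (\<bar>H (u x)\<bar> powr (p * \<sigma>) + 2)" by linarith
  qed
  also have "\<dots> = 2 powr p * (Y + 2 * m)"
    using intH[OF psig] intconst[of 2] by (simp add: Y_def)
  also have "\<dots> \<le> 2 powr p * (3 * m)"
    using \<open>Y \<le> m\<close> by (intro mult_left_mono) auto
  finally have "(\<integral>x. exp (p * \<beta> * T (u x)) \<partial>\<mu>) \<le> (3 * 2 powr p) * m" by simp
  then have "ennreal (\<integral>x. exp (p * \<beta> * T (u x)) \<partial>\<mu>) \<le> ennreal (3 * 2 powr p) * ennreal m"
    by (simp add: ennreal_mult[symmetric] m_def ennreal_leI)
  moreover have "(\<integral>\<^sup>+x. ennreal (exp (p * \<beta> * T (u x))) \<partial>\<mu>) = ennreal (\<integral>x. exp (p * \<beta> * T (u x)) \<partial>\<mu>)"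
    using intE by (intro nn_integral_eq_integral) auto
  moreover have "ennreal m = emeasure \<mu> \<Omega>"
    by (simp add: m_def emeasure_eq_measure)
  ultimately show ?thesis by simp
qed

end

text \<open>The sequence consists of difference quotients at 0 of
  \<open>\<lambda>s. arctan (t * s)\<close>, with increments \<open>1 / (n + 1)\<close>.\<close>

lemma arctan_truncation_tendsto:
  "(\<lambda>n. real (Suc n) * arctan (t / real (Suc n))) \<longlonglongrightarrow> t"
proof -
  have "((\<lambda>s. arctan (t * s)) has_real_derivative t) (at 0)"
    by (auto intro!: derivative_eq_intros)
  then have "(\<lambda>s. arctan (t * s) / s) \<midarrow>0\<rightarrow> t"
    by (simp add: DERIV_def)
  moreover have "filterlim (\<lambda>n. inverse (real (Suc n))) (at 0) sequentially"
    using LIMSEQ_inverse_real_of_nat by (intro filterlim_atI) auto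
  ultimately have "(\<lambda>n. arctan (t * inverse (real (Suc n))) / inverse (real (Suc n))) \<longlonglongrightarrow> t"
    by (rule filterlim_compose)
  then show ?thesis by (simp add: divide_inverse mult.commute)
qed

theorem theorem1p6:
  fixes \<Omega> :: "(real ^ 'n) set"
    and Q :: "real ^ 'n \<Rightarrow> real ^ 'n ^ 'n"
    and v f :: "real ^ 'n \<Rightarrow> real"
    and p \<sigma> :: real
  assumes p: "1 < p" and sigma: "1 < \<sigma>"
    and domain: "open \<Omega>" "connected \<Omega>" "bounded \<Omega>" "\<Omega> \<noteq> {}"
    and Q_measurable: "Q \<in> borel_measurable (lebesgue_on \<Omega>)"
    and Q_nonneg: "\<And>x. x \<in> \<Omega> \<Longrightarrow> nonneg_definite (Q x)"
    and v_nonneg: "\<And>x. x \<in> \<Omega> \<Longrightarrow> 0 \<le> v x"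
    and v_loc: "v \<in> Lp_loc 1 \<Omega>"
    and omega_loc: "(\<lambda>x. op_norm (Q x)) \<in> Lp_loc (p / 2) \<Omega>"
    and weight: "\<exists>C>0. AE x in lebesgue_on \<Omega>. v x \<ge> C * op_norm (Q x) powr (p / 2)"
    and sobolev: "\<exists>C>0. \<forall>\<phi> \<in> Lip0 \<Omega>.
           Lp_norm (p * \<sigma>) (weighted \<Omega> v) \<phi> \<le> C * QLp_norm p \<Omega> Q (grad \<phi>)"
    and f: "f \<in> Lp_space (\<sigma> / (\<sigma> - 1)) (weighted \<Omega> v)"
  shows "\<exists>\<gamma>>0. \<exists>C>0. \<forall>u g.
           weak_solution p \<sigma> \<Omega> Q v f u g \<and> u \<in> Linf_space (weighted \<Omega> v) \<longrightarrow>
           (\<integral>\<^sup>+ x. ennreal (exp (\<gamma> * u x)) \<partial>weighted \<Omega> v)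
             \<le> ennreal C * emeasure (weighted \<Omega> v) \<Omega>"
proof (cases "emeasure (weighted \<Omega> v) \<Omega> = \<infinity>")
  case True
  \<comment> \<open>The right-hand side is infinite, so any positive constants will do; both are
    taken to be 1.\<close>
  then show ?thesis
    by (intro exI[of _ 1] conjI) (auto simp: ennreal_mult_top)
next
  case False
  interpret degenerate_domain \<Omega> Q v p
    using assms by unfold_locales auto
  have sp: "space \<mu> = \<Omega>" by (simp add: weighted_def)
  have fin: "finite_measure \<mu>"
    using False by (intro finite_measureI) (simp add: sp)
  obtain S where S: "0 < S"
    and sob: "\<And>\<phi>. \<phi> \<in> Lip0 \<Omega> \<Longrightarrow> Lp_norm (p * \<sigma>) \<mu> \<phi> \<le> S * QLp_norm p \<Omega> Q (grad \<phi>)"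
    using sobolev by blast
  define F where "F = (\<integral>x. \<bar>f x\<bar> powr (\<sigma> / (\<sigma> - 1)) \<partial>\<mu>)"
  \<comment> \<open>The coefficient of \<open>\<beta> powr (p - 1)\<close> in the smallness
    condition.\<close>
  define E where "E = S powr p * 2 powr p / p * 2 * (F + 2 * (2 * 2 powr p) powr \<sigma>)"
  have F: "0 \<le> F" by (simp add: F_def)
  have E: "0 < E" using S p F by (simp add: E_def add_nonneg_pos)
  \<comment> \<open>The solution of \<open>E * \<beta> powr (p - 1) = 1 / 2\<close>; it depends on
    \<open>p\<close>, \<open>\<sigma>\<close>, \<open>S\<close> and \<open>F\<close> only.\<close>
  define \<beta> where "\<beta> = (1 / (2 * E)) powr (1 / (p - 1))"
  have \<beta>: "0 < \<beta>" using E by (simp add: \<beta>_def)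
  have "\<beta> powr (p - 1) = 1 / (2 * E)" using E p by (simp add: \<beta>_def powr_powr)
  then have "E * \<beta> powr (p - 1) < 1" using E by simp
  then have small: "S powr p * 2 powr p * (\<beta> powr (p - 1) / p) * 2 * (F + 2 * (2 * 2 powr p) powr \<sigma>) < 1"
    by (simp add: E_def mult_ac)
  have "(\<integral>\<^sup>+ x. ennreal (exp (p * \<beta> * u x)) \<partial>\<mu>) \<le> ennreal (3 * 2 powr p) * emeasure \<mu> \<Omega>"
    if sol: "weak_solution p \<sigma> \<Omega> Q v f u g" for u g
  proof -
    \<comment> \<open>The truncation is bounded by \<open>(n + 1) * pi / 2\<close> and has
      derivative in \<open>(0, 1]\<close>; the shift \<open>Suc n\<close> keeps the denominator
      nonzero.\<close>
    define T where "T n t = real (Suc n) * arctan (t / real (Suc n))" for n t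
    have [measurable]: "T n \<in> borel_measurable borel" for n
      unfolding T_def by (intro borel_measurable_continuous_onI continuous_intros) auto
    have um: "u \<in> borel_measurable \<mu>"
      using sol by (auto simp: weak_solution_def QH0_def Lp_space_def)
    have bound: "(\<integral>\<^sup>+ x. ennreal (exp (p * \<beta> * T n (u x))) \<partial>\<mu>)
        \<le> ennreal (3 * 2 powr p) * emeasure \<mu> \<Omega>" for n
    proof (rule truncated_exponential_estimate[OF sigma fin S sob f sol \<beta> small[unfolded F_def]])
      show "(T n has_real_derivative inverse (1 + (t / real (Suc n))\<^sup>2)) (at t)" for t
        unfolding T_def[abs_def] by (auto intro!: derivative_eq_intros)
      show "continuous_on UNIV (\<lambda>t. inverse (1 + (t / real (Suc n))\<^sup>2))"
        by (intro continuous_intros) (auto simp: add_nonneg_eq_0_iff)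
      show "0 < inverse (1 + (t / real (Suc n))\<^sup>2)" for t
        by (simp add: add_pos_nonneg)
      show "inverse (1 + (t / real (Suc n))\<^sup>2) \<le> 1" for t
        by (rule inverse_le_1_iff[THEN iffD2]) simp
      show "T n 0 = 0" by (simp add: T_def)
      show "\<bar>T n t\<bar> \<le> real (Suc n) * (pi / 2)" for t
        unfolding T_def abs_mult
        using arctan_lbound[of "t / real (Suc n)"] arctan_ubound[of "t / real (Suc n)"]
        by (intro mult_mono) auto
    qed
    have "(\<lambda>n. ennreal (exp (p * \<beta> * T n (u x)))) \<longlonglongrightarrow> ennreal (exp (p * \<beta> * u x))" for x
      using arctan_truncation_tendsto[of "u x"] unfolding T_def
      by (intro tendsto_ennrealI tendsto_exp tendsto_mult tendsto_const)
    \<comment> \<open>The integrand is rewritten as a lower limit in preparation for Fatou's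
      lemma.\<close>
    then have "(\<integral>\<^sup>+ x. ennreal (exp (p * \<beta> * u x)) \<partial>\<mu>)
        = (\<integral>\<^sup>+ x. liminf (\<lambda>n. ennreal (exp (p * \<beta> * T n (u x)))) \<partial>\<mu>)"
      by (intro nn_integral_cong lim_imp_Liminf[symmetric]) auto
    also have "\<dots> \<le> liminf (\<lambda>n. \<integral>\<^sup>+ x. ennreal (exp (p * \<beta> * T n (u x))) \<partial>\<mu>)"
      using um by (intro nn_integral_liminf) measurable
    also have "\<dots> \<le> ennreal (3 * 2 powr p) * emeasure \<mu> \<Omega>"
      using bound by (intro Liminf_le) (auto intro: always_eventually)
    finally show ?thesis .
  qed
  \<comment> \<open>Both \<open>p * \<beta>\<close> and \<open>3 * 2 powr p\<close> were fixed
    before \<open>u\<close> and \<open>g\<close>.\<close>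
  then show ?thesis
    using \<beta> p by (intro exI[of _ "p * \<beta>"] conjI exI[of _ "3 * 2 powr p"]) auto
qed

end
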